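(* Let $\mathcal{G}$ be a minor-closed class of graphs of bounded treewidth, and let $t\ge 1$ be an integer. Then $\mathrm{col}_\star(\mathcal{G})\le t$ if and only if there exists an integer $m\ge 1$ such that $K_{t,m}\notin\mathcal{G}$ and $I_{t-1}+P_m\notin\mathcal{G}$.
   Context: All graphs are finite and simple. A class $\mathcal{G}$ of graphs is a (proper) minor-closed class if $\mathcal{G}$ does not contain all graphs and every minor of a graph in $\mathcal{G}$ also belongs to $\mathcal{G}$. A class has bounded treewidth if there is an integer $w$ with $\mathrm{tw}(G)\le w$ for all $G$ in the class. For an integer $t$, a $t$-island in a graph $G$ is a non-empty set $S\subseteq V(G)$ such that every vertex of $S$ has fewer than $t$ neighbors in $V(G)\setminus S$. For an integer $C\ge1$, $\mathrm{col}_C(G)$ is the smallest integer $t$ such that every non-empty subgraph of $G$ contains a $t$-island of size at most $C$. For a class $\mathcal{G}$, $\mathrm{col}_\star(\mathcal{G})$ is the smallest integer $t$ such that there exists $C\ge 1$ with $\mathrm{col}_C(G)\le t$ for every $G\in\mathcal{G}$ ($\infty$ if no such $t$ exists). $I_n+P_m$ denotes the graph consisting of a path on $m$ vertices together with $n$ additional vertices, each adjacent to all vertices of the path (and not to each other). $K_{t,m}$ is the complete bipartite graph. *)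

theory Defs
  imports Main "HOL-Library.Extended_Nat"
begin

datatype 'a graph = Graph (verts: "'a set") (edges: "'a set set")

definition simple_graph :: "'a graph \<Rightarrow> bool" where
  "simple_graph G \<longleftrightarrow> finite (verts G) \<and> (\<forall>e\<in>edges G. e \<subseteq> verts G \<and> card e = 2)"

definition adj :: "'a graph \<Rightarrow> 'a \<Rightarrow> 'a \<Rightarrow> bool" where
  "adj G u v \<longleftrightarrow> {u, v} \<in> edges G"

definition subgraph :: "'a graph \<Rightarrow> 'a graph \<Rightarrow> bool" where
  "subgraph H G \<longleftrightarrow> simple_graph H \<and> verts H \<subseteq> verts G \<and> edges H \<subseteq> edges G"

definition induced :: "'a graph \<Rightarrow> 'a set \<Rightarrow> 'a graph" where
  "induced G S = Graph (verts G \<inter> S) {e \<in> edges G. e \<subseteq> S}"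

text \<open>Connected graphs are non-empty by convention.\<close>

definition connected_graph :: "'a graph \<Rightarrow> bool" where
  "connected_graph G \<longleftrightarrow>
     verts G \<noteq> {} \<and> (\<forall>u\<in>verts G. \<forall>v\<in>verts G. (adj G)\<^sup>*\<^sup>* u v)"

text \<open>
  A minor is given by a model: pairwise disjoint connected branch sets in \<open>G\<close>, one for each
  vertex of \<open>H\<close>, with an edge of \<open>G\<close> between the branch sets of any two adjacent vertices of \<open>H\<close>.
  This is invariant under isomorphism of \<open>H\<close> and of \<open>G\<close>.
\<close>

definition minor :: "'b graph \<Rightarrow> 'a graph \<Rightarrow> bool" where
  "minor H G \<longleftrightarrow> (\<exists>\<beta> :: 'b \<Rightarrow> 'a set.
     (\<forall>x\<in>verts H. \<beta> x \<subseteq> verts G \<and> connected_graph (induced G (\<beta> x))) \<and>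
     (\<forall>x\<in>verts H. \<forall>y\<in>verts H. x \<noteq> y \<longrightarrow> \<beta> x \<inter> \<beta> y = {}) \<and>
     (\<forall>x y. adj H x y \<longrightarrow> (\<exists>u\<in>\<beta> x. \<exists>v\<in>\<beta> y. adj G u v)))"

text \<open>
  A class of graphs is a set of graphs on natural numbers. Every finite graph is isomorphic to
  one of these, and closure under minors includes closure under isomorphism.
\<close>

definition minor_closed_class :: "nat graph set \<Rightarrow> bool" where
  "minor_closed_class \<G> \<longleftrightarrow>
     (\<forall>G\<in>\<G>. simple_graph G) \<and>
     (\<exists>G. simple_graph G \<and> G \<notin> \<G>) \<and>
     (\<forall>G\<in>\<G>. \<forall>H. simple_graph H \<and> minor H G \<longrightarrow> H \<in> \<G>)"

definition cycle :: "'a graph \<Rightarrow> 'a list \<Rightarrow> bool" where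
  "cycle G xs \<longleftrightarrow>
     length xs \<ge> 3 \<and> distinct xs \<and> successively (adj G) xs \<and> adj G (last xs) (hd xs)"

definition tree :: "'a graph \<Rightarrow> bool" where
  "tree T \<longleftrightarrow> simple_graph T \<and> connected_graph T \<and> (\<nexists>xs. cycle T xs)"

definition tree_decomposition :: "'a graph \<Rightarrow> nat graph \<Rightarrow> (nat \<Rightarrow> 'a set) \<Rightarrow> bool" where
  "tree_decomposition G T B \<longleftrightarrow>
     tree T \<and>
     (\<Union>x\<in>verts T. B x) = verts G \<and>
     (\<forall>e\<in>edges G. \<exists>x\<in>verts T. e \<subseteq> B x) \<and>
     (\<forall>v\<in>verts G. connected_graph (induced T {x. v \<in> B x}))"

text \<open>The subtraction truncates only if all bags are empty, so only the null graph is affected: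
  its treewidth is 0 here.\<close>

definition width :: "nat graph \<Rightarrow> (nat \<Rightarrow> 'a set) \<Rightarrow> nat" where
  "width T B = Max ((\<lambda>x. card (B x)) ` verts T) - 1"

definition treewidth :: "'a graph \<Rightarrow> nat" where
  "treewidth G = (LEAST w. \<exists>T B. tree_decomposition G T B \<and> width T B = w)"

definition bounded_treewidth :: "'a graph set \<Rightarrow> bool" where
  "bounded_treewidth \<G> \<longleftrightarrow> (\<exists>w. \<forall>G\<in>\<G>. treewidth G \<le> w)"

definition island :: "nat \<Rightarrow> 'a graph \<Rightarrow> 'a set \<Rightarrow> bool" where
  "island t G S \<longleftrightarrow>
     S \<noteq> {} \<and> S \<subseteq> verts G \<and> (\<forall>v\<in>S. card {w \<in> verts G - S. adj G v w} < t)"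

definition col :: "nat \<Rightarrow> 'a graph \<Rightarrow> nat" where
  "col C G = (LEAST t. \<forall>H. subgraph H G \<and> verts H \<noteq> {} \<longrightarrow> (\<exists>S. island t H S \<and> card S \<le> C))"

text \<open>The infimum of the empty set is \<open>\<infinity>\<close>.\<close>

definition col_star :: "'a graph set \<Rightarrow> enat" where
  "col_star \<G> = Inf {enat t | t. \<exists>C\<ge>1. \<forall>G\<in>\<G>. col C G \<le> t}"

definition complete_bipartite :: "nat \<Rightarrow> nat \<Rightarrow> nat graph" where
  "complete_bipartite n m = Graph {..<n + m} {{i, j} | i j. i < n \<and> n \<le> j \<and> j < n + m}"

text \<open>The graph \<open>I\<^sub>n + P\<^sub>m\<close>: the path is on the vertices \<open>n, \<dots>, n + m - 1\<close>.\<close>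

definition indep_join_path :: "nat \<Rightarrow> nat \<Rightarrow> nat graph" where
  "indep_join_path n m = Graph {..<n + m}
     ({{i, j} | i j. i < n \<and> n \<le> j \<and> j < n + m} \<union> {{j, Suc j} | j. n \<le> j \<and> Suc j < n + m})"

end

theory Submission
  imports Defs "HOL-Library.FuncSet" "HOL-Library.Infinite_Set"
begin

text \<open>
  Necessity holds because in \<open>K\<^sub>t\<^sub>,\<^sub>m\<close> and \<open>I\<^sub>t\<^sub>-\<^sub>1 + P\<^sub>m\<close> every \<open>t\<close>-island is large. For
  sufficiency, suppose a graph of bounded treewidth has no small \<open>t\<close>-island and neither obstruction
  as a minor. A small connected set that a bag separates from the rest is not an island, so it
  contains a vertex with \<open>t\<close> neighbours in the bag; hence few of them hang off one bag, and
  descending along large components gives a long chain \<open>U\<^sub>0 \<subset> U\<^sub>1 \<subset> \<dots>\<close> of small sets with bounded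
  boundary. Choosing a subchain of constant boundary size \<open>k\<close> without smaller cuts in between,
  Menger's theorem links the boundaries by \<open>k\<close> disjoint paths. As the part of the graph between two
  boundaries is not an island, it contains a vertex with \<open>t\<close> neighbours on distinct paths. Many such
  vertices yield \<open>K\<^sub>t\<^sub>,\<^sub>m\<close> if they lie off the paths and \<open>I\<^sub>t\<^sub>-\<^sub>1 + P\<^sub>m\<close> if they lie on one of them.
\<close>

section \<open>Finite combinatorics\<close>

text \<open>The order of quantifiers is the main obstacle: the chain length that forces an
  obstruction must not depend on the island bound \<open>C\<close>, because \<open>C\<close> is
  chosen afterwards, large enough for a descent of that length. So
  \<open>obstruction_from_chain\<close> fixes \<open>n\<close> before \<open>C\<close>, although its
  sets have at most \<open>C\<close> vertices. The descent starts from a smallest connected set with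
  more than \<open>C\<close> vertices whose boundary fits into a bag. Every proper subset of this
  kind then has at most \<open>C\<close> vertices, so it cannot be an island. The absence of smaller
  cuts provides \<open>k\<close> paths, and since each cut has exactly \<open>k\<close> vertices,
  each path meets it exactly once. Hence neighbours in one cut lie on distinct paths, whereas
  neighbours in two different cuts may share a path. The sunflower lemma removes this difficulty: a
  vertex common to two cuts is common to all, which forces the outside neighbours of a suitable
  vertex into a single cut.\<close>

lemma pigeonhole_fibre:
  assumes "finite A" "f \<in> A \<rightarrow> B" "finite B" "card B * n < card A"
  obtains b where "b \<in> B" "n < card {a \<in> A. f a = b}"
proof -
  have "A \<noteq> {}"
    using assms(4) by auto
  then have "B \<noteq> {}"
    using assms(2) by auto
  then obtain b where b: "b \<in> B" "card (f -` {b} \<inter> A) * card B \<ge> card A"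
    using pigeonhole_card[OF assms(2,1,3)] by blast
  have "f -` {b} \<inter> A = {a \<in> A. f a = b}"
    by auto
  then have "card B * n < card B * card {a \<in> A. f a = b}"
    using order.strict_trans2[OF assms(4) b(2)] by (simp add: mult.commute)
  then have "n < card {a \<in> A. f a = b}"
    by simp
  then show thesis
    using b that by blast
qed

text \<open>The Erdos-Rado argument: a maximal pairwise disjoint subfamily either has at least
  \<open>n\<close> members, or its bounded union meets every other set, so that many sets share a
  point \<open>z\<close>; this point is deleted before induction. Indexing allows equal sets, since
  different sets of a chain can have the same boundary.\<close>

lemma sunflower:
  "\<exists>N. \<forall>(I :: 'i set) (X :: 'i \<Rightarrow> 'a set).
     finite I \<longrightarrow> N \<le> card I \<longrightarrow> (\<forall>i\<in>I. finite (X i) \<and> card (X i) \<le> k) \<longrightarrow>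
     (\<exists>J\<subseteq>I. card J = n \<and> (\<exists>Z. \<forall>i\<in>J. \<forall>j\<in>J. i \<noteq> j \<longrightarrow> X i \<inter> X j = Z))"
proof (induction k)
  case 0
  have "\<exists>J\<subseteq>I. card J = n \<and> (\<exists>Z. \<forall>i\<in>J. \<forall>j\<in>J. i \<noteq> j \<longrightarrow> X i \<inter> X j = Z)"
    if "finite I" "n \<le> card I" "\<forall>i\<in>I. finite (X i) \<and> card (X i) \<le> 0" for I :: "'i set" and X :: "'i \<Rightarrow> 'a set"
  proof -
    obtain J where "J \<subseteq> I" "card J = n"
      using obtain_subset_with_card_n[OF \<open>n \<le> card I\<close>] by blast
    moreover have "\<forall>i\<in>I. X i = {}"
      using that(3) by (auto simp: card_eq_0_iff)
    then have "\<forall>i\<in>J. \<forall>j\<in>J. i \<noteq> j \<longrightarrow> X i \<inter> X j = {}"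
      using \<open>J \<subseteq> I\<close> by blast
    ultimately show ?thesis by blast
  qed
  then show ?case by blast
next
  case (Suc k)
  then obtain N where N: "\<And>(I :: 'i set) (X :: 'i \<Rightarrow> 'a set).
     finite I \<Longrightarrow> N \<le> card I \<Longrightarrow> (\<forall>i\<in>I. finite (X i) \<and> card (X i) \<le> k) \<Longrightarrow>
     (\<exists>J\<subseteq>I. card J = n \<and> (\<exists>Z. \<forall>i\<in>J. \<forall>j\<in>J. i \<noteq> j \<longrightarrow> X i \<inter> X j = Z))"
    by metis
  have "\<exists>J\<subseteq>I. card J = n \<and> (\<exists>Z. \<forall>i\<in>J. \<forall>j\<in>J. i \<noteq> j \<longrightarrow> X i \<inter> X j = Z)"
    if fin: "finite I" and big: "n + Suc (n * Suc k * N) \<le> card I"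
      and X: "\<forall>i\<in>I. finite (X i) \<and> card (X i) \<le> Suc k"
    for I :: "'i set" and X :: "'i \<Rightarrow> 'a set"
  proof (cases "\<exists>J\<subseteq>I. card J = n \<and> (\<forall>i\<in>J. \<forall>j\<in>J. i \<noteq> j \<longrightarrow> X i \<inter> X j = {})")
    case True
    then obtain J where "J \<subseteq> I" "card J = n" "\<forall>i\<in>J. \<forall>j\<in>J. i \<noteq> j \<longrightarrow> X i \<inter> X j = {}"
      by blast
    then show ?thesis
      by (intro exI[of _ J] conjI exI[of _ "{}"])
  next
    case False
    define \<J> where "\<J> = {J. J \<subseteq> I \<and> (\<forall>i\<in>J. \<forall>j\<in>J. i \<noteq> j \<longrightarrow> X i \<inter> X j = {})}"
    have "finite \<J>" "{} \<in> \<J>"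
      using fin by (auto simp: \<J>_def)
    then obtain J where J: "J \<in> \<J>" "\<And>J'. J' \<in> \<J> \<Longrightarrow> J \<subseteq> J' \<Longrightarrow> J' = J"
      using finite_has_maximal[of \<J>] by (metis empty_iff)
    have JI: "J \<subseteq> I" and disj: "\<And>i j. i \<in> J \<Longrightarrow> j \<in> J \<Longrightarrow> i \<noteq> j \<Longrightarrow> X i \<inter> X j = {}"
      using J(1) by (simp_all add: \<J>_def)
    have finJ: "finite J"
      using JI fin by (rule finite_subset)
    have "card J < n"
    proof (rule ccontr)
      assume "\<not> card J < n"
      then obtain J' where "J' \<subseteq> J" "card J' = n"
        using obtain_subset_with_card_n by (metis not_less)
      moreover have "J' \<subseteq> I" "\<forall>i\<in>J'. \<forall>j\<in>J'. i \<noteq> j \<longrightarrow> X i \<inter> X j = {}"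
        using JI disj \<open>J' \<subseteq> J\<close> by (simp_all add: subset_iff)
      ultimately show False
        using False by metis
    qed
    define D where "D = (\<Union>j\<in>J. X j)"
    have "finite D"
      using finJ JI X by (auto simp: D_def)
    have "card D \<le> (\<Sum>j\<in>J. card (X j))"
      unfolding D_def by (rule card_UN_le[OF finJ])
    also have "\<dots> \<le> (\<Sum>j\<in>J. Suc k)"
      using JI X by (intro sum_mono) blast
    also have "\<dots> \<le> n * Suc k"
      using mult_le_mono1[of "card J" n "Suc k"] \<open>card J < n\<close> by simp
    finally have cardD: "card D \<le> n * Suc k" .
    have meet: "\<exists>z. z \<in> D \<inter> X i" if i: "i \<in> I - J" for i
    proof (rule ccontr)
      assume "\<not> ?thesis"
      then have "\<forall>j\<in>J. X i \<inter> X j = {}"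
        by (auto simp: D_def)
      then have "insert i J \<in> \<J>"
        using JI disj i by (auto simp: \<J>_def)
      then show False
        using J(2)[of "insert i J"] i by auto
    qed
    then obtain f where f: "\<And>i. i \<in> I - J \<Longrightarrow> f i \<in> D \<inter> X i"
      by metis
    \<comment> \<open>Fewer than \<open>n\<close> indices lie in \<open>J\<close>, so more than
      \<open>n * Suc k * N\<close> remain for the pigeonhole principle over the points of
      \<open>D\<close>.\<close>
    have "card D * N \<le> n * Suc k * N"
      using cardD by (rule mult_le_mono1)
    also have "\<dots> < card (I - J)"
      using big \<open>card J < n\<close> card_Diff_subset[OF finJ JI] by linarith
    finally have lt: "card D * N < card (I - J)" .
    have "finite (I - J)" "f \<in> I - J \<rightarrow> D"
      using fin f by auto
    then obtain z where z: "z \<in> D" "N < card {i \<in> I - J. f i = z}"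
      using pigeonhole_fibre[OF _ _ \<open>finite D\<close> lt] by blast
    define I' where "I' = {i \<in> I - J. f i = z}"
    have I': "finite I'" "N \<le> card I'" "I' \<subseteq> I" "\<And>i. i \<in> I' \<Longrightarrow> z \<in> X i"
      using z f fin by (auto simp: I'_def)
    have "\<forall>i\<in>I'. finite (X i - {z}) \<and> card (X i - {z}) \<le> k"
    proof
      fix i assume "i \<in> I'"
      then have "finite (X i)" "card (X i) \<le> Suc k" "z \<in> X i"
        using X I'(3,4) by auto
      then show "finite (X i - {z}) \<and> card (X i - {z}) \<le> k"
        by simp
    qed
    then have "\<exists>K\<subseteq>I'. card K = n \<and>
        (\<exists>Z. \<forall>i\<in>K. \<forall>j\<in>K. i \<noteq> j \<longrightarrow> (X i - {z}) \<inter> (X j - {z}) = Z)"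
      by (rule N[OF I'(1,2)])
    then obtain K Z where K: "K \<subseteq> I'" "card K = n"
      "\<forall>i\<in>K. \<forall>j\<in>K. i \<noteq> j \<longrightarrow> (X i - {z}) \<inter> (X j - {z}) = Z"
      by (elim exE conjE)
    have "X i \<inter> X j = insert z Z" if "i \<in> K" "j \<in> K" "i \<noteq> j" for i j
    proof -
      have "(X i - {z}) \<inter> (X j - {z}) = Z" "z \<in> X i" "z \<in> X j"
        using K(1,3) I'(4) that by auto
      then show ?thesis by blast
    qed
    then have "\<forall>i\<in>K. \<forall>j\<in>K. i \<noteq> j \<longrightarrow> X i \<inter> X j = insert z Z"
      by simp
    moreover have "K \<subseteq> I"
      using K(1) I'(3) by simp
    ultimately show ?thesis
      using K(2) by metis
  qed
  then show ?case by blast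
qed

section \<open>Paths and Menger's theorem\<close>

lemma rtranclp_distinct_path:
  assumes "R\<^sup>*\<^sup>* a b"
  shows "\<exists>xs. xs \<noteq> [] \<and> hd xs = a \<and> last xs = b \<and> successively R xs \<and> distinct xs"
  using assms
proof (induction rule: converse_rtranclp_induct)
  case base
  show ?case by (rule exI[of _ "[b]"]) simp
next
  case (step a c)
  then obtain xs where xs: "xs \<noteq> []" "hd xs = c" "last xs = b" "successively R xs" "distinct xs"
    by blast
  show ?case
  proof (cases "a \<in> set xs")
    case True
    then obtain ys zs where "xs = ys @ a # zs"
      by (meson split_list)
    then show ?thesis
      using xs by (intro exI[of _ "a # zs"]) (auto simp: successively_append_iff)
  next
    case False
    then show ?thesis
      using xs step.hyps by (intro exI[of _ "a # xs"]) (auto simp: successively_Cons)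
  qed
qed

text \<open>A digraph is a set of ordered pairs, so that the induction can delete one directed edge;
  a graph enters through its symmetric adjacency relation. Walks may repeat vertices, which spares a
  distinctness proof when pieces of two paths are spliced. One-vertex walks in
  \<open>A \<inter> B\<close> count.\<close>

definition walk :: "('a \<times> 'a) set \<Rightarrow> 'a set \<Rightarrow> 'a set \<Rightarrow> 'a list \<Rightarrow> bool" where
  "walk E A B xs \<longleftrightarrow>
     xs \<noteq> [] \<and> successively (\<lambda>u v. (u, v) \<in> E) xs \<and> hd xs \<in> A \<and> last xs \<in> B"

definition separates :: "('a \<times> 'a) set \<Rightarrow> 'a set \<Rightarrow> 'a set \<Rightarrow> 'a set \<Rightarrow> bool" where
  "separates E A B Y \<longleftrightarrow> (\<forall>xs. walk E A B xs \<longrightarrow> set xs \<inter> Y \<noteq> {})"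

definition disjoint_paths :: "('a \<times> 'a) set \<Rightarrow> 'a set \<Rightarrow> 'a set \<Rightarrow> 'a list set \<Rightarrow> bool" where
  "disjoint_paths E A B P \<longleftrightarrow>
     finite P \<and> (\<forall>p\<in>P. walk E A B p \<and> distinct p) \<and>
     (\<forall>p\<in>P. \<forall>q\<in>P. p \<noteq> q \<longrightarrow> set p \<inter> set q = {})"

text \<open>The final vertex \<open>z\<close> may equal \<open>x\<close>: the new edge is used only
  by a step that leaves \<open>x\<close>.\<close>

lemma successively_insert_avoiding_source:
  assumes "successively (\<lambda>u v. (u, v) \<in> insert (x, y) E) (ys @ [z])" "x \<notin> set ys"
  shows "successively (\<lambda>u v. (u, v) \<in> E) (ys @ [z])"
  using assms by (induction ys) (auto simp: successively_Cons)

lemma successively_insert_avoiding_target: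
  assumes "successively (\<lambda>u v. (u, v) \<in> insert (x, y) E) (z # zs)" "y \<notin> set zs"
  shows "successively (\<lambda>u v. (u, v) \<in> E) (z # zs)"
  using assms by (induction zs arbitrary: z) (auto simp: successively_Cons)

lemma separates_insert_edge:
  assumes "separates E A B S"
  shows "separates (insert (x, y) E) A B (insert x S)" "separates (insert (x, y) E) A B (insert y S)"
proof -
  have "set xs \<inter> insert x S \<noteq> {}" if xs: "walk (insert (x, y) E) A B xs" for xs
  proof
    assume disj: "set xs \<inter> insert x S = {}"
    obtain ys z where "xs = ys @ [z]"
      using xs by (metis walk_def rev_exhaust)
    then have "walk E A B xs"
      using xs disj successively_insert_avoiding_source[of x y E ys z] by (auto simp: walk_def)
    then show False
      using assms disj by (auto simp: separates_def)
  qed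
  then show "separates (insert (x, y) E) A B (insert x S)"
    by (simp add: separates_def)
  have "set xs \<inter> insert y S \<noteq> {}" if xs: "walk (insert (x, y) E) A B xs" for xs
  proof
    assume disj: "set xs \<inter> insert y S = {}"
    obtain ys z where "xs = z # ys"
      using xs by (metis walk_def neq_Nil_conv)
    then have "walk E A B xs"
      using xs disj successively_insert_avoiding_target[of x y E z ys] by (auto simp: walk_def)
    then show False
      using assms disj by (auto simp: separates_def)
  qed
  then show "separates (insert (x, y) E) A B (insert y S)"
    by (simp add: separates_def)
qed

text \<open>Cut a walk from \<open>A\<close> to \<open>B\<close> at its first vertex in
  \<open>insert x S\<close>. The initial piece never leaves \<open>x\<close>, so it does not use
  \<open>(x, y)\<close> and must already meet \<open>Y\<close>.\<close>

lemma separates_via_source: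
  assumes "separates (insert (x, y) E) A B (insert x S)" "separates E A (insert x S) Y"
  shows "separates (insert (x, y) E) A B Y"
  unfolding separates_def
proof (intro allI impI)
  fix xs
  assume xs: "walk (insert (x, y) E) A B xs"
  then have "\<exists>v\<in>set xs. v \<in> insert x S"
    using assms(1) unfolding separates_def by blast
  then obtain ys z zs where split: "xs = ys @ z # zs" "z \<in> insert x S" "\<forall>v\<in>set ys. v \<notin> insert x S"
    using split_list_first_prop[of xs "\<lambda>v. v \<in> insert x S"] by blast
  have "successively (\<lambda>u v. (u, v) \<in> insert (x, y) E) (ys @ [z])"
    using xs by (auto simp: walk_def split(1) successively_append_iff)
  then have "walk E A (insert x S) (ys @ [z])"
    using xs split successively_insert_avoiding_source[of x y E ys z]
    by (cases ys) (auto simp: walk_def)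
  then show "set xs \<inter> Y \<noteq> {}"
    using assms(2) split(1) unfolding separates_def by fastforce
qed

lemma separates_via_target:
  assumes "separates (insert (x, y) E) A B (insert y S)" "separates E (insert y S) B Y"
  shows "separates (insert (x, y) E) A B Y"
  unfolding separates_def
proof (intro allI impI)
  fix xs
  assume xs: "walk (insert (x, y) E) A B xs"
  then have "\<exists>v\<in>set xs. v \<in> insert y S"
    using assms(1) unfolding separates_def by blast
  then obtain ys z zs where split: "xs = ys @ z # zs" "z \<in> insert y S" "\<forall>v\<in>set zs. v \<notin> insert y S"
    using split_list_last_prop[of xs "\<lambda>v. v \<in> insert y S"] by blast
  have "successively (\<lambda>u v. (u, v) \<in> insert (x, y) E) (z # zs)"
    using xs by (auto simp: walk_def split(1) successively_append_iff)
  then have "walk E (insert y S) B (z # zs)"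
    using xs split successively_insert_avoiding_target[of x y E z zs]
    by (auto simp: walk_def)
  then show "set xs \<inter> Y \<noteq> {}"
    using assms(2) split(1) unfolding separates_def by fastforce
qed

text \<open>Serves the gluing in \<open>Menger\<close>: every vertex of a minimum separator is the
  end of exactly one path.\<close>

lemma disjoint_paths_last:
  assumes "disjoint_paths E A B P" "finite B" "card P = card B"
  shows "inj_on last P" "last ` P = B"
proof -
  show inj: "inj_on last P"
    using assms(1) unfolding disjoint_paths_def walk_def inj_on_def
    by (metis disjoint_iff last_in_set)
  have "last ` P \<subseteq> B"
    using assms(1) by (auto simp: disjoint_paths_def walk_def)
  then show "last ` P = B"
    using assms(2,3) card_image[OF inj] by (simp add: card_subset_eq)
qed

lemma disjoint_paths_hd:
  assumes "disjoint_paths E A B P" "finite A" "card P = card A"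
  shows "inj_on hd P" "hd ` P = A"
proof -
  show inj: "inj_on hd P"
    using assms(1) unfolding disjoint_paths_def walk_def inj_on_def
    by (metis disjoint_iff hd_in_set)
  have "hd ` P \<subseteq> A"
    using assms(1) by (auto simp: disjoint_paths_def walk_def)
  then show "hd ` P = A"
    using assms(2,3) card_image[OF inj] by (simp add: card_subset_eq)
qed

text \<open>Goering's proof: delete a directed edge \<open>(x, y)\<close>. If this creates a separator \<open>S\<close> of size \<open>k - 1\<close>,
  then \<open>S \<union> {x}\<close> and \<open>S \<union> {y}\<close> are minimum separators of the whole digraph, and the paths to the
  former and from the latter meet only in \<open>S\<close>.\<close>

theorem Menger:
  assumes "finite E" "finite A"
    and "\<And>Y. finite Y \<Longrightarrow> separates E A B Y \<Longrightarrow> k \<le> card Y"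
  shows "\<exists>P. disjoint_paths E A B P \<and> card P = k"
  using assms
proof (induction E arbitrary: A B rule: finite_induct)
  case empty
  have "separates {} A B (A \<inter> B)"
    unfolding separates_def
  proof (intro allI impI)
    fix xs assume xs: "walk {} A B xs"
    then obtain x where "xs = [x]"
      unfolding walk_def by (metis (no_types, lifting) empty_iff list.exhaust successively_Cons)
    then show "set xs \<inter> (A \<inter> B) \<noteq> {}"
      using xs by (auto simp: walk_def)
  qed
  then have "k \<le> card (A \<inter> B)"
    using empty by blast
  then obtain S where S: "S \<subseteq> A \<inter> B" "card S = k" "finite S"
    by (metis empty.prems(1) finite_Int finite_subset obtain_subset_with_card_n)
  then have "disjoint_paths {} A B ((\<lambda>s. [s]) ` S)"
    by (auto simp: disjoint_paths_def walk_def)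
  moreover have "card ((\<lambda>s. [s]) ` S) = k"
    using S by (simp add: card_image inj_on_def)
  ultimately show ?case by blast
next
  case (insert e E)
  obtain x y where e: "e = (x, y)"
    by (cases e)
  show ?case
  proof (cases "\<forall>Y. finite Y \<longrightarrow> separates E A B Y \<longrightarrow> k \<le> card Y")
    case True
    then obtain P where P: "disjoint_paths E A B P" "card P = k"
      using insert.IH[of A B] insert.prems(1) by blast
    have "successively (\<lambda>u v. (u, v) \<in> insert e E) p" if "successively (\<lambda>u v. (u, v) \<in> E) p" for p
      by (rule successively_mono[OF that]) simp
    then have "disjoint_paths (insert e E) A B P"
      using P(1) by (auto simp: disjoint_paths_def walk_def)
    then show ?thesis
      using P(2) by blast
  next
    case False
    then obtain S where S: "finite S" "separates E A B S" "card S < k"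
      by (auto simp: not_le)
    have sep: "separates (insert (x, y) E) A B (insert x S)" "separates (insert (x, y) E) A B (insert y S)"
      using separates_insert_edge[OF S(2)] by auto
    \<comment> \<open>Both sets separate the larger digraph, so they have at least \<open>k\<close>
      elements, while \<open>S\<close> has fewer than \<open>k\<close>.\<close>
    have card: "card (insert x S) = k" "card (insert y S) = k"
      using insert.prems(2)[of "insert x S"] insert.prems(2)[of "insert y S"] sep S e
      by (auto simp: card_insert_if split: if_splits)
    then have notin: "x \<notin> S" "y \<notin> S"
      using S(3) insert_absorb by fastforce+
    \<comment> \<open>Whatever separates \<open>A\<close> from \<open>insert x S\<close> without the
      edge also separates \<open>A\<close> from \<open>B\<close> with it, so it has at least
      \<open>k\<close> elements and the induction hypothesis applies. The paths \<open>Q\<close>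
      arise symmetrically.\<close>
    have "\<exists>P. disjoint_paths E A (insert x S) P \<and> card P = k"
      using insert.prems separates_via_source[OF sep(1)] e by (intro insert.IH) auto
    then obtain P where P: "disjoint_paths E A (insert x S) P" "card P = k"
      by blast
    have "\<exists>Q. disjoint_paths E (insert y S) B Q \<and> card Q = k"
      using insert.prems separates_via_target[OF sep(2)] e S(1) by (intro insert.IH) auto
    then obtain Q where Q: "disjoint_paths E (insert y S) B Q" "card Q = k"
      by blast
    have lastP: "inj_on last P" "last ` P = insert x S"
      using disjoint_paths_last[OF P(1)] card P(2) S(1) by auto
    have hdQ: "inj_on hd Q" "hd ` Q = insert y S"
      using disjoint_paths_hd[OF Q(1)] card Q(2) S(1) by auto
    have Pp: "p \<noteq> []" "distinct p" "successively (\<lambda>u v. (u, v) \<in> E) p" "hd p \<in> A" if "p \<in> P" for p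
      using P(1) that by (auto simp: disjoint_paths_def walk_def)
    have Qq: "q \<noteq> []" "distinct q" "successively (\<lambda>u v. (u, v) \<in> E) q" "last q \<in> B" if "q \<in> Q" for q
      using Q(1) that by (auto simp: disjoint_paths_def walk_def)
    have end_P: "last p = s" if "p \<in> P" "s \<in> set p" "s \<in> S" for p s
    proof -
      obtain p' where "p' \<in> P" "last p' = s"
        using lastP(2) \<open>s \<in> S\<close> by (metis image_iff insert_iff)
      then show ?thesis
        using P(1) that Pp(1)[of p'] unfolding disjoint_paths_def by (metis disjoint_iff last_in_set)
    qed
    have start_Q: "hd q = s" if "q \<in> Q" "s \<in> set q" "s \<in> S" for q s
    proof -
      obtain q' where "q' \<in> Q" "hd q' = s"
        using hdQ(2) \<open>s \<in> S\<close> by (metis image_iff insert_iff)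
      then show ?thesis
        using Q(1) that Qq(1)[of q'] unfolding disjoint_paths_def by (metis disjoint_iff hd_in_set)
    qed
    \<comment> \<open>The part of \<open>p\<close> up to \<open>u\<close> followed by the part of
      \<open>q\<close> after \<open>u\<close> is a walk from \<open>A\<close> to \<open>B\<close>
      without the deleted edge, so it meets \<open>S\<close>. A vertex of \<open>S\<close> is only
      the last one on \<open>p\<close> and only the first one on \<open>q\<close>; hence it is
      \<open>u\<close>.\<close>
    have meet: "u \<in> S \<and> last p = u \<and> hd q = u"
      if "p \<in> P" "q \<in> Q" "u \<in> set p" "u \<in> set q" for p q u
    proof -
      obtain p1 p2 where p: "p = p1 @ u # p2"
        using split_list[OF \<open>u \<in> set p\<close>] by blast
      obtain q1 q2 where q: "q = q1 @ u # q2"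
        using split_list[OF \<open>u \<in> set q\<close>] by blast
      have "walk E A B (p1 @ u # q2)"
        using Pp[OF \<open>p \<in> P\<close>] Qq[OF \<open>q \<in> Q\<close>] unfolding walk_def p q
        by (auto simp: successively_append_iff hd_append split: if_splits)
      then obtain s where s: "s \<in> S" "s \<in> set (p1 @ u # q2)"
        using S(2) unfolding separates_def by blast
      have "s \<notin> set q2"
      proof
        assume "s \<in> set q2"
        then have "hd q = s"
          using start_Q[OF \<open>q \<in> Q\<close> _ s(1)] q by auto
        then show False
          using Qq(2)[OF \<open>q \<in> Q\<close>] \<open>s \<in> set q2\<close> unfolding q by (cases q1) auto
      qed
      moreover have "s \<notin> set p1"
      proof
        assume "s \<in> set p1"
        then have "last p = s"
          using end_P[OF \<open>p \<in> P\<close> _ s(1)] p by auto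
        then have "s \<in> set (u # p2)"
          unfolding p by (metis last_appendR last_in_set list.distinct(1))
        then show False
          using Pp(2)[OF \<open>p \<in> P\<close>] \<open>s \<in> set p1\<close> unfolding p by auto
      qed
      ultimately have "s = u"
        using s by auto
      then show ?thesis
        using end_P start_Q that s(1) by blast
    qed
    define pp where "pp = inv_into P last"
    define qq where "qq = inv_into Q hd"
    have pp: "pp s \<in> P" "last (pp s) = s" if "s \<in> insert x S" for s
      using that lastP(2) by (simp_all add: pp_def inv_into_into f_inv_into_f)
    have qq: "qq s \<in> Q" "hd (qq s) = s" if "s \<in> insert y S" for s
      using that hdQ(2) by (simp_all add: qq_def inv_into_into f_inv_into_f)
    \<comment> \<open>The path ending in \<open>x\<close> is continued through the edge
      \<open>(x, y)\<close>; any other path is continued at its end \<open>s\<close>, where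
      \<open>tl\<close> avoids listing \<open>s\<close> twice. The map \<open>r\<close> names the
      start of the continuation.\<close>
    define g where "g s = (if s = x then pp x @ qq y else pp s @ tl (qq s))" for s
    define r where "r s = (if s = x then y else s)" for s
    have r: "r s \<in> insert y S" "r s = r s' \<Longrightarrow> s = s'" if "s \<in> insert x S" "s' \<in> insert x S" for s s'
      using that notin by (auto simp: r_def split: if_splits)
    have set_g: "set (g s) \<subseteq> set (pp s) \<union> set (qq (r s))" for s
      unfolding g_def r_def by (cases "qq s") auto
    have disj: "set (g s) \<inter> set (g s') = {}" if s: "s \<in> insert x S" "s' \<in> insert x S" "s \<noteq> s'" for s s'
    proof -
      have "pp s \<noteq> pp s'"
        using pp s by metis
      then have "set (pp s) \<inter> set (pp s') = {}"
        using P(1) pp s by (auto simp: disjoint_paths_def)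
      moreover have "qq (r s) \<noteq> qq (r s')"
        using qq(2)[OF r(1)] r(2) s by metis
      then have "set (qq (r s)) \<inter> set (qq (r s')) = {}"
        using Q(1) qq(1)[OF r(1)] s by (meson disjoint_paths_def)
      moreover have "set (pp a) \<inter> set (qq (r b)) = {}" if "a \<in> insert x S" "b \<in> insert x S" "a \<noteq> b" for a b
      proof (rule ccontr)
        assume "\<not> ?thesis"
        then obtain u where "u \<in> set (pp a)" "u \<in> set (qq (r b))"
          by blast
        then have "u \<in> S" "u = a" "u = r b"
          using meet[of "pp a" "qq (r b)" u] pp[of a] qq[OF r(1)[of b]] that by auto
        then show False
          using that notin by (auto simp: r_def split: if_splits)
      qed
      ultimately show ?thesis
        using set_g[of s] set_g[of s'] s by blast
    qed
    have walk_g: "walk (insert e E) A B (g s) \<and> distinct (g s)" if s: "s \<in> insert x S" for s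
    proof (cases "s = x")
      case True
      have "u \<notin> set (qq y)" if "u \<in> set (pp x)" for u
        using meet[of "pp x" "qq y" u] pp[of x] qq[of y] that notin by auto
      moreover have "successively (\<lambda>u v. (u, v) \<in> insert e E) (pp x @ qq y)"
        using Pp(3)[of "pp x"] Qq(3)[of "qq y"] pp[of x] qq[of y] e
        by (auto simp: successively_append_iff intro: successively_mono)
      ultimately show ?thesis
        using True pp[of x] qq[of y] Pp[of "pp x"] Qq[of "qq y"]
        by (auto simp: g_def walk_def)
    next
      case False
      then have sS: "s \<in> S"
        using s by auto
      obtain zs where zs: "qq s = s # zs"
        using qq[of s] Qq(1)[of "qq s"] sS by (metis insertCI list.collapse)
      have "u \<notin> set zs" if "u \<in> set (pp s)" for u
        using meet[of "pp s" "qq s" u] pp[of s] qq[of s] that sS Qq(2)[of "qq s"] zs by auto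
      moreover have "successively (\<lambda>u v. (u, v) \<in> insert e E) (pp s @ zs)"
        using Pp(3)[of "pp s"] Qq(3)[of "qq s"] pp[of s] qq[of s] sS zs
        by (auto simp: successively_append_iff successively_Cons intro: successively_mono)
      moreover have "last (pp s @ zs) \<in> B"
        using Qq(4)[of "qq s"] qq[of s] pp[of s] sS zs by (cases zs) auto
      ultimately show ?thesis
        using False pp[of s] qq[of s] Pp[of "pp s"] Qq[of "qq s"] sS zs
        by (auto simp: g_def walk_def)
    qed
    have "inj_on g (insert x S)"
    proof (rule inj_onI, rule ccontr)
      fix s s' assume *: "s \<in> insert x S" "s' \<in> insert x S" "g s = g s'" "s \<noteq> s'"
      then have "g s = []"
        using disj[of s s'] by simp
      then show False
        using walk_g[OF *(1)] by (simp add: walk_def)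
    qed
    then have "card (g ` insert x S) = k"
      using card by (simp only: card_image)
    moreover have "disjoint_paths (insert e E) A B (g ` insert x S)"
      using walk_g disj S(1) unfolding disjoint_paths_def by blast
    ultimately show ?thesis by blast
  qed
qed

section \<open>Connectivity and minors\<close>

lemma adj_commute: "adj G u v \<longleftrightarrow> adj G v u"
  by (simp add: adj_def insert_commute)

lemma simple_graph_adjD:
  assumes "simple_graph G" "adj G u v"
  shows "u \<noteq> v" "u \<in> verts G" "v \<in> verts G"
  using assms unfolding simple_graph_def adj_def by (force, blast+)

lemma adj_induced: "adj (induced G S) u v \<longleftrightarrow> adj G u v \<and> u \<in> S \<and> v \<in> S"
  by (auto simp: adj_def induced_def)

lemma verts_induced: "verts (induced G S) = verts G \<inter> S"
  by (simp add: induced_def)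

lemma rtranclp_adj_commute: "(adj G)\<^sup>*\<^sup>* u v \<longleftrightarrow> (adj G)\<^sup>*\<^sup>* v u"
  using symp_rtranclp[of "adj G"] by (metis adj_commute sympI sympE)

lemma rtranclp_adj_induced_mono:
  assumes "(adj (induced G S))\<^sup>*\<^sup>* u v" "S \<subseteq> T"
  shows "(adj (induced G T))\<^sup>*\<^sup>* u v"
proof -
  have "adj (induced G S) \<le> adj (induced G T)"
    using assms(2) by (auto simp: adj_induced)
  then show ?thesis
    using assms(1) rtranclp_mono by blast
qed

lemma connected_induced_iff:
  assumes "S \<subseteq> verts G"
  shows "connected_graph (induced G S) \<longleftrightarrow>
    S \<noteq> {} \<and> (\<forall>u\<in>S. \<forall>v\<in>S. (adj (induced G S))\<^sup>*\<^sup>* u v)"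
  using assms by (simp add: connected_graph_def verts_induced Int_absorb1)

lemma connected_singleton:
  assumes "v \<in> verts G"
  shows "connected_graph (induced G {v})"
  using assms by (simp add: connected_induced_iff)

lemma connected_Un:
  assumes "connected_graph (induced G S)" "connected_graph (induced G T)"
    and "S \<subseteq> verts G" "T \<subseteq> verts G" "a \<in> S" "b \<in> T" "adj G a b"
  shows "connected_graph (induced G (S \<union> T))"
proof -
  let ?R = "(adj (induced G (S \<union> T)))\<^sup>*\<^sup>*"
  have S: "?R u v" if "u \<in> S" "v \<in> S" for u v
    using assms(1,3) that by (auto simp: connected_induced_iff intro: rtranclp_adj_induced_mono)
  have T: "?R u v" if "u \<in> T" "v \<in> T" for u v
    using assms(2,4) that by (auto simp: connected_induced_iff intro: rtranclp_adj_induced_mono)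
  have "?R a b"
    using assms(5-7) by (intro r_into_rtranclp) (simp add: adj_induced)
  then have ST: "?R u v" if "u \<in> S" "v \<in> T" for u v
    using S[OF that(1) assms(5)] T[OF assms(6) that(2)] by (meson rtranclp_trans)
  then have "?R v u" if "u \<in> S" "v \<in> T" for u v
    using that rtranclp_adj_commute by metis
  then show ?thesis
    using S T ST assms(3-5) by (subst connected_induced_iff) auto
qed

lemma connected_path:
  assumes "successively (adj G) xs" "xs \<noteq> []" "set xs \<subseteq> verts G"
  shows "connected_graph (induced G (set xs))"
  using assms
proof (induction xs)
  case (Cons x xs)
  show ?case
  proof (cases "xs = []")
    case True
    then show ?thesis
      using Cons.prems connected_singleton by fastforce
  next
    case False
    have "connected_graph (induced G ({x} \<union> set xs))"
    proof (rule connected_Un[of _ _ _ x "hd xs"])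
      show "connected_graph (induced G {x})"
        using Cons.prems by (intro connected_singleton) auto
      show "connected_graph (induced G (set xs))"
        using Cons False by (simp add: successively_Cons)
    qed (use Cons.prems False in \<open>auto simp: successively_Cons\<close>)
    then show ?thesis by simp
  qed
qed simp

text \<open>Cut the path behind its first vertex in \<open>W\<close> and recurse; the last segment
  keeps the whole remainder. The clause \<open>hd xs \<in> \<beta> 0\<close> serves the induction:
  it supplies the edge from a newly cut segment to the next one.\<close>

lemma path_segments:
  assumes "successively (adj G) xs" "distinct xs" "set xs \<subseteq> verts G" "Suc m \<le> card (set xs \<inter> W)"
  shows "\<exists>\<beta> :: nat \<Rightarrow> 'a set.
    (\<forall>i\<le>m. \<beta> i \<subseteq> set xs \<and> connected_graph (induced G (\<beta> i)) \<and> \<beta> i \<inter> W \<noteq> {}) \<and>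
    (\<forall>i\<le>m. \<forall>j\<le>m. i \<noteq> j \<longrightarrow> \<beta> i \<inter> \<beta> j = {}) \<and>
    (\<forall>i<m. \<exists>u\<in>\<beta> i. \<exists>v\<in>\<beta> (Suc i). adj G u v) \<and> hd xs \<in> \<beta> 0"
  using assms
proof (induction m arbitrary: xs)
  case 0
  then have "set xs \<inter> W \<noteq> {}"
    by auto
  then have "xs \<noteq> []"
    by auto
  then show ?case
    using 0 connected_path[of G xs] \<open>set xs \<inter> W \<noteq> {}\<close> by (intro exI[of _ "\<lambda>_. set xs"]) auto
next
  case (Suc m)
  then have "\<exists>x\<in>set xs. x \<in> W"
    by (metis Int_iff all_not_in_conv card.empty not_less_eq_eq zero_le)
  then obtain ys x zs where xs: "xs = ys @ x # zs" "x \<in> W" "\<forall>y\<in>set ys. y \<notin> W"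
    using split_list_first_prop[of xs "\<lambda>v. v \<in> W"] by blast
  have "set xs \<inter> W = insert x (set zs \<inter> W)" "x \<notin> set zs"
    using xs Suc.prems(2) by auto
  then have card: "Suc m \<le> card (set zs \<inter> W)"
    using Suc.prems(4) by simp
  then have "set zs \<noteq> {}"
    by auto
  then have ne: "zs \<noteq> []"
    by simp
  have "successively (adj G) zs" "distinct zs" "set zs \<subseteq> verts G"
    using Suc.prems by (auto simp: xs(1) successively_append_iff successively_Cons)
  from Suc.IH[OF this card] obtain \<beta> :: "nat \<Rightarrow> 'a set" where
    "\<forall>i\<le>m. \<beta> i \<subseteq> set zs \<and> connected_graph (induced G (\<beta> i)) \<and> \<beta> i \<inter> W \<noteq> {}"
    "\<forall>i\<le>m. \<forall>j\<le>m. i \<noteq> j \<longrightarrow> \<beta> i \<inter> \<beta> j = {}"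
    "\<forall>i<m. \<exists>u\<in>\<beta> i. \<exists>v\<in>\<beta> (Suc i). adj G u v" "hd zs \<in> \<beta> 0"
    by (elim exE conjE)
  note \<beta> = this[rule_format]
  define \<gamma> where "\<gamma> = case_nat (set (ys @ [x])) \<beta>"
  have \<gamma>: "\<gamma> 0 = set (ys @ [x])" "\<And>i. \<gamma> (Suc i) = \<beta> i"
    by (simp_all add: \<gamma>_def)
  have ysx: "connected_graph (induced G (set (ys @ [x])))"
    using Suc.prems xs(1) by (intro connected_path) (auto simp: successively_append_iff)
  have "adj G x (hd zs)"
    using Suc.prems(1) ne by (simp add: xs(1) successively_append_iff successively_Cons)
  have disj: "set (ys @ [x]) \<inter> set zs = {}"
    using Suc.prems(2) xs(1) by auto
  have "\<gamma> i \<subseteq> set xs \<and> connected_graph (induced G (\<gamma> i)) \<and> \<gamma> i \<inter> W \<noteq> {}" if "i \<le> Suc m" for i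
  proof (cases i)
    case 0
    then show ?thesis
      using ysx xs by (auto simp: \<gamma>)
  next
    case (Suc j)
    then show ?thesis
      using \<beta>(1)[of j] that xs(1) by (auto simp: \<gamma>)
  qed
  moreover have "\<gamma> i \<inter> \<gamma> j = {}" if "i \<le> Suc m" "j \<le> Suc m" "i \<noteq> j" for i j
  proof (cases i; cases j)
    fix i' j' assume "i = Suc i'" "j = Suc j'"
    then show ?thesis
      using that \<beta>(2)[of i' j'] by (simp add: \<gamma>)
  next
    fix j' assume "i = 0" "j = Suc j'"
    then show ?thesis
      using that \<beta>(1)[of j'] disj by (simp add: \<gamma>) blast
  next
    fix i' assume "i = Suc i'" "j = 0"
    then show ?thesis
      using that \<beta>(1)[of i'] disj by (simp add: \<gamma>) blast
  qed (use that in simp)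
  moreover have "\<exists>u\<in>\<gamma> i. \<exists>v\<in>\<gamma> (Suc i). adj G u v" if "i < Suc m" for i
  proof (cases i)
    case 0
    then show ?thesis
      using \<open>adj G x (hd zs)\<close> \<beta>(4) by (auto simp: \<gamma>)
  next
    case (Suc j)
    then show ?thesis
      using \<beta>(3)[of j] that by (simp add: \<gamma>)
  qed
  moreover have "hd xs \<in> \<gamma> 0"
    by (simp add: \<gamma> xs(1) hd_append)
  ultimately show ?case
    by (intro exI[of _ \<gamma>]) blast
qed

section \<open>The two obstruction graphs and their models\<close>

lemma adj_complete_bipartite:
  "adj (complete_bipartite n m) x y \<longleftrightarrow>
     x < n \<and> n \<le> y \<and> y < n + m \<or> y < n \<and> n \<le> x \<and> x < n + m"
  unfolding adj_def complete_bipartite_def by (auto simp: doubleton_eq_iff)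

lemma adj_indep_join_path:
  "adj (indep_join_path n m) x y \<longleftrightarrow>
     x < n \<and> n \<le> y \<and> y < n + m \<or> y < n \<and> n \<le> x \<and> x < n + m \<or>
     n \<le> x \<and> y = Suc x \<and> y < n + m \<or> n \<le> y \<and> x = Suc y \<and> x < n + m"
  unfolding adj_def indep_join_path_def by (auto simp: doubleton_eq_iff)

lemma simple_complete_bipartite: "simple_graph (complete_bipartite n m)"
  by (auto simp: simple_graph_def complete_bipartite_def)

lemma simple_indep_join_path: "simple_graph (indep_join_path n m)"
  by (auto simp: simple_graph_def indep_join_path_def)

lemma minor_complete_bipartite:
  assumes \<T>: "finite \<T>" "card \<T> = t" "\<And>S. S \<in> \<T> \<Longrightarrow> S \<subseteq> verts G \<and> connected_graph (induced G S)"
    "\<And>S T. S \<in> \<T> \<Longrightarrow> T \<in> \<T> \<Longrightarrow> S \<noteq> T \<Longrightarrow> S \<inter> T = {}"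
    and W: "finite W" "card W = m" "W \<subseteq> verts G"
    and WT: "\<And>v S. v \<in> W \<Longrightarrow> S \<in> \<T> \<Longrightarrow> v \<notin> S \<and> (\<exists>u\<in>S. adj G v u)"
  shows "minor (complete_bipartite t m) G"
proof -
  obtain f where f: "bij_betw f {0..<t} \<T>"
    using ex_bij_betw_nat_finite \<T>(1,2) by blast
  obtain g where g: "bij_betw g {0..<m} W"
    using ex_bij_betw_nat_finite W(1,2) by blast
  have fT: "f i \<in> \<T>" if "i < t" for i
    using f that by (auto simp: bij_betw_def)
  have gW: "g i \<in> W" if "i < m" for i
    using g that by (auto simp: bij_betw_def)
  have f_inj: "f i \<noteq> f j" if "i < t" "j < t" "i \<noteq> j" for i j
    using f that by (auto simp: bij_betw_def inj_on_def)
  have g_inj: "g i \<noteq> g j" if "i < m" "j < m" "i \<noteq> j" for i j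
    using g that by (auto simp: bij_betw_def inj_on_def)
  define \<beta> where "\<beta> x = (if x < t then f x else {g (x - t)})" for x
  have "\<beta> x \<subseteq> verts G \<and> connected_graph (induced G (\<beta> x))" if "x < t + m" for x
  proof (cases "x < t")
    case True
    then show ?thesis
      using \<T>(3)[OF fT] by (simp add: \<beta>_def)
  next
    case False
    then have "g (x - t) \<in> verts G"
      using gW[of "x - t"] W(3) that by auto
    then show ?thesis
      using False connected_singleton by (auto simp: \<beta>_def)
  qed
  moreover have "\<beta> x \<inter> \<beta> y = {}" if "x < t + m" "y < t + m" "x \<noteq> y" for x y
  proof (cases "x < t"; cases "y < t")
    assume "x < t" "y < t"
    then show ?thesis
      using \<T>(4)[OF fT fT f_inj] that by (simp add: \<beta>_def)
  next
    assume "x < t" "\<not> y < t"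
    then show ?thesis
      using WT[OF gW[of "y - t"] fT[of x]] that by (simp add: \<beta>_def)
  next
    assume "\<not> x < t" "y < t"
    then show ?thesis
      using WT[OF gW[of "x - t"] fT[of y]] that by (simp add: \<beta>_def)
  next
    assume "\<not> x < t" "\<not> y < t"
    then show ?thesis
      using g_inj[of "x - t" "y - t"] that by (simp add: \<beta>_def)
  qed
  moreover have "\<exists>u\<in>\<beta> x. \<exists>v\<in>\<beta> y. adj G u v" if "adj (complete_bipartite t m) x y" for x y
  proof -
    have edge: "\<exists>u\<in>\<beta> x. \<exists>v\<in>\<beta> y. adj G u v \<and> adj G v u" if "x < t" "t \<le> y" "y < t + m" for x y
      using WT[OF gW[of "y - t"] fT[of x]] that by (auto simp: \<beta>_def adj_commute)
    show ?thesis
      using that edge[of x y] edge[of y x] unfolding adj_complete_bipartite by blast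
  qed
  ultimately show ?thesis
    unfolding minor_def by (intro exI[of _ \<beta>]) (auto simp: complete_bipartite_def)
qed

text \<open>Contracting \<open>xs\<close> to \<open>m\<close> segments that each contain a vertex of
  \<open>W\<close> gives a path whose vertices are all adjacent to every contracted member of
  \<open>\<T>\<close>.\<close>

lemma minor_indep_join_path:
  assumes \<T>: "finite \<T>" "card \<T> = t" "\<And>S. S \<in> \<T> \<Longrightarrow> S \<subseteq> verts G \<and> connected_graph (induced G S)"
    "\<And>S T. S \<in> \<T> \<Longrightarrow> T \<in> \<T> \<Longrightarrow> S \<noteq> T \<Longrightarrow> S \<inter> T = {}"
    and xs: "successively (adj G) xs" "distinct xs" "set xs \<subseteq> verts G" "m \<le> card (set xs \<inter> W)"
    "\<And>S. S \<in> \<T> \<Longrightarrow> S \<inter> set xs = {}"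
    and WT: "\<And>v S. v \<in> W \<Longrightarrow> S \<in> \<T> \<Longrightarrow> \<exists>u\<in>S. adj G v u"
    and "m \<ge> 1"
  shows "minor (indep_join_path t m) G"
proof -
  obtain f where f: "bij_betw f {0..<t} \<T>"
    using ex_bij_betw_nat_finite \<T>(1,2) by blast
  have fT: "f i \<in> \<T>" if "i < t" for i
    using f that by (auto simp: bij_betw_def)
  have f_inj: "f i \<noteq> f j" if "i < t" "j < t" "i \<noteq> j" for i j
    using f that by (auto simp: bij_betw_def inj_on_def)
  have "Suc (m - 1) \<le> card (set xs \<inter> W)"
    using xs(4) \<open>m \<ge> 1\<close> by simp
  from path_segments[OF xs(1-3) this] obtain \<gamma> :: "nat \<Rightarrow> 'a set" where
    "\<forall>i\<le>m - 1. \<gamma> i \<subseteq> set xs \<and> connected_graph (induced G (\<gamma> i)) \<and> \<gamma> i \<inter> W \<noteq> {}"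
    "\<forall>i\<le>m - 1. \<forall>j\<le>m - 1. i \<noteq> j \<longrightarrow> \<gamma> i \<inter> \<gamma> j = {}"
    "\<forall>i<m - 1. \<exists>u\<in>\<gamma> i. \<exists>v\<in>\<gamma> (Suc i). adj G u v"
    by (elim exE conjE)
  note \<gamma> = this[rule_format]
  define \<beta> where "\<beta> x = (if x < t then f x else \<gamma> (x - t))" for x
  have bound: "x - t \<le> m - 1" if "x < t + m" for x
    using that by linarith
  have \<gamma>xs: "\<gamma> (x - t) \<subseteq> set xs" if "x < t + m" "\<not> x < t" for x
    using \<gamma>(1)[OF bound[of x]] that by simp
  have "\<beta> x \<subseteq> verts G \<and> connected_graph (induced G (\<beta> x))" if "x < t + m" for x
  proof (cases "x < t")
    case True
    then show ?thesis
      using \<T>(3)[OF fT] by (simp add: \<beta>_def)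
  next
    case False
    then show ?thesis
      using \<gamma>(1)[OF bound[of x]] that xs(3) by (auto simp: \<beta>_def)
  qed
  moreover have "\<beta> x \<inter> \<beta> y = {}" if "x < t + m" "y < t + m" "x \<noteq> y" for x y
  proof (cases "x < t"; cases "y < t")
    assume "x < t" "y < t"
    then show ?thesis
      using \<T>(4)[OF fT fT f_inj] that by (simp add: \<beta>_def)
  next
    assume *: "x < t" "\<not> y < t"
    then have "f x \<inter> \<gamma> (y - t) = {}"
      using xs(5)[OF fT[of x]] \<gamma>xs[of y] that by blast
    then show ?thesis
      using * by (simp add: \<beta>_def)
  next
    assume *: "\<not> x < t" "y < t"
    then have "f y \<inter> \<gamma> (x - t) = {}"
      using xs(5)[OF fT[of y]] \<gamma>xs[of x] that by blast
    then show ?thesis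
      using * by (auto simp: \<beta>_def)
  next
    assume "\<not> x < t" "\<not> y < t"
    then show ?thesis
      using \<gamma>(2)[of "x - t" "y - t"] that by (simp add: \<beta>_def)
  qed
  moreover have "\<exists>u\<in>\<beta> x. \<exists>v\<in>\<beta> y. adj G u v" if "adj (indep_join_path t m) x y" for x y
  proof -
    have edge: "\<exists>u\<in>\<beta> x. \<exists>v\<in>\<beta> y. adj G u v \<and> adj G v u" if "x < t" "t \<le> y" "y < t + m" for x y
    proof -
      obtain v where "v \<in> \<gamma> (y - t)" "v \<in> W"
        using \<gamma>(1)[OF bound[OF \<open>y < t + m\<close>]] by blast
      moreover obtain u where "u \<in> f x" "adj G v u"
        using WT[OF \<open>v \<in> W\<close> fT[OF \<open>x < t\<close>]] by blast
      ultimately show ?thesis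
        using that adj_commute[of G u v] by (auto simp: \<beta>_def)
    qed
    have step: "\<exists>u\<in>\<beta> x. \<exists>v\<in>\<beta> (Suc x). adj G u v \<and> adj G v u" if "t \<le> x" "Suc x < t + m" for x
      using \<gamma>(3)[of "x - t"] that by (auto simp: \<beta>_def Suc_diff_le adj_commute)
    show ?thesis
      using that edge[of x y] edge[of y x] step[of x] step[of y] unfolding adj_indep_join_path by blast
  qed
  ultimately show ?thesis
    unfolding minor_def by (intro exI[of _ \<beta>]) (auto simp: indep_join_path_def)
qed

section \<open>Long chains of sets with small boundary\<close>

definition boundary :: "'a graph \<Rightarrow> 'a set \<Rightarrow> 'a set" where
  "boundary G U = {v \<in> verts G - U. \<exists>u\<in>U. adj G u v}"

definition no_small_island :: "nat \<Rightarrow> nat \<Rightarrow> 'a graph \<Rightarrow> bool" where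
  "no_small_island t C G \<longleftrightarrow> simple_graph G \<and> (\<forall>S. island t G S \<longrightarrow> C < card S)"

definition has_obstruction :: "nat \<Rightarrow> nat \<Rightarrow> 'a graph \<Rightarrow> bool" where
  "has_obstruction t m G \<longleftrightarrow>
     minor (complete_bipartite t m) G \<or> minor (indep_join_path (t - 1) m) G"

lemma no_small_islandD:
  assumes "no_small_island t C G" "S \<noteq> {}" "S \<subseteq> verts G" "card S \<le> C"
  obtains v where "v \<in> S" "t \<le> card {w \<in> verts G - S. adj G v w}"
  using assms unfolding no_small_island_def island_def by (metis not_le)

section \<open>Boundaries, and obstructions found from disjoint paths\<close>

lemma boundary_iff:
  assumes "simple_graph G"
  shows "v \<in> boundary G U \<longleftrightarrow> v \<notin> U \<and> (\<exists>u\<in>U. adj G u v)"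
  using assms by (auto simp: boundary_def dest: simple_graph_adjD)

lemma finite_boundary: "simple_graph G \<Longrightarrow> finite (boundary G U)"
  by (simp add: boundary_def simple_graph_def)

lemma boundary_of_subset:
  assumes "simple_graph G" "U \<subseteq> V" "v \<in> boundary G U" "v \<notin> V"
  shows "v \<in> boundary G V"
  using assms by (auto simp: boundary_iff)

lemma path_meets_boundary:
  assumes "simple_graph G" "successively (adj G) xs" "xs \<noteq> []"
    and "hd xs \<in> U \<union> boundary G U" "last xs \<notin> U"
  shows "\<exists>z\<in>set xs. z \<in> boundary G U"
  using assms(2-)
proof (induction xs)
  case (Cons x xs)
  show ?case
  proof (cases "x \<in> boundary G U")
    case False
    then have "x \<in> U" "xs \<noteq> []"
      using Cons.prems by auto
    then have "hd xs \<in> U \<union> boundary G U"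
      using Cons.prems(1) assms(1) by (auto simp: successively_Cons boundary_iff)
    then show ?thesis
      using Cons \<open>xs \<noteq> []\<close> by (auto simp: successively_Cons)
  qed simp
qed simp

text \<open>Choosing a point of \<open>X\<close> in each \<open>A p\<close> is injective by
  disjointness, hence onto \<open>X\<close> by counting, so no set contains a second point of
  \<open>X\<close>.\<close>

lemma disjoint_transversal:
  assumes "finite P" "\<And>p q. p \<in> P \<Longrightarrow> q \<in> P \<Longrightarrow> p \<noteq> q \<Longrightarrow> A p \<inter> A q = {}"
    and "finite X" "card X = card P" "\<And>p. p \<in> P \<Longrightarrow> A p \<inter> X \<noteq> {}"
  shows "X \<subseteq> (\<Union>p\<in>P. A p)" "\<And>p u u'. p \<in> P \<Longrightarrow> u \<in> A p \<inter> X \<Longrightarrow> u' \<in> A p \<inter> X \<Longrightarrow> u = u'"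
proof -
  have "\<forall>p\<in>P. \<exists>u. u \<in> A p \<inter> X"
    using assms(5) by blast
  then obtain f where f: "\<forall>p\<in>P. f p \<in> A p \<inter> X"
    by (rule bchoice[THEN exE])
  have "inj_on f P"
    using f assms(2) by (metis IntD1 disjoint_iff inj_onI)
  moreover have "f ` P \<subseteq> X"
    using f by auto
  ultimately have X: "f ` P = X"
    using assms(3,4) by (metis card_image card_subset_eq)
  then show "X \<subseteq> (\<Union>p\<in>P. A p)"
    using f by auto
  have "u = f p" if "p \<in> P" "u \<in> A p \<inter> X" for p u
  proof -
    obtain q where "q \<in> P" "u = f q"
      using \<open>u \<in> A p \<inter> X\<close> X by auto
    then have "u \<in> A q" "u \<in> A p"
      using f \<open>u \<in> A p \<inter> X\<close> by auto
    then have "p = q"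
      using assms(2)[OF \<open>p \<in> P\<close> \<open>q \<in> P\<close>] by blast
    then show ?thesis
      using \<open>u = f q\<close> by simp
  qed
  then show "\<And>p u u'. p \<in> P \<Longrightarrow> u \<in> A p \<inter> X \<Longrightarrow> u' \<in> A p \<inter> X \<Longrightarrow> u = u'"
    by metis
qed

text \<open>A vertex outside all paths is adjacent to \<open>t\<close> of them, a vertex on a path to \<open>t - 1\<close> others.
  Many vertices of the first kind give \<open>K\<^sub>t\<^sub>,\<^sub>m\<close>; many of the second kind on the same path
  give \<open>I\<^sub>t\<^sub>-\<^sub>1 + P\<^sub>m\<close>.\<close>

lemma obstruction_from_paths:
  assumes G: "simple_graph G"
    and P: "finite P" "\<And>p. p \<in> P \<Longrightarrow> p \<noteq> [] \<and> successively (adj G) p \<and> distinct p \<and> set p \<subseteq> verts G"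
    and disj: "\<And>p q. p \<in> P \<Longrightarrow> q \<in> P \<Longrightarrow> p \<noteq> q \<Longrightarrow> set p \<inter> set q = {}"
    and W: "W \<subseteq> verts G" "4 ^ card P * m < card W"
    and nbrs: "\<And>v. v \<in> W \<Longrightarrow> \<exists>N. t \<le> card N \<and> N \<subseteq> (\<Union>p\<in>P. set p) \<and> (\<forall>u\<in>N. adj G v u) \<and>
      (\<forall>p\<in>P. \<forall>u\<in>N \<inter> set p. \<forall>u'\<in>N \<inter> set p. u = u')"
    and "m \<ge> 1"
  shows "has_obstruction t m G"
proof -
  have finW: "finite W"
    using W(2) by (metis card.infinite not_less0)
  define Q where "Q v = {p \<in> P. v \<in> set p}" for v
  define T where "T v = {p \<in> P. v \<notin> set p \<and> (\<exists>u\<in>set p. adj G v u)}" for v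
  have QT: "t \<le> card (T v) + card (Q v)" if v: "v \<in> W" for v
  proof -
    obtain N where N: "t \<le> card N" "N \<subseteq> (\<Union>p\<in>P. set p)" "\<forall>u\<in>N. adj G v u"
      "\<forall>p\<in>P. \<forall>u\<in>N \<inter> set p. \<forall>u'\<in>N \<inter> set p. u = u'"
      using nbrs[OF v] by (elim exE conjE)
    have "\<forall>u\<in>N. \<exists>p. p \<in> P \<and> u \<in> set p"
      using N(2) by blast
    then obtain f where f: "\<forall>u\<in>N. f u \<in> P \<and> u \<in> set (f u)"
      by (rule bchoice[THEN exE])
    \<comment> \<open>\<open>N\<close> has at most one vertex on each path, so distinct neighbours
      count distinct paths.\<close>
    have "inj_on f N"
      using f N(4) by (metis IntI inj_onI)
    then have "card N = card (f ` N)"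
      by (simp add: card_image)
    also have "f ` N \<subseteq> T v \<union> Q v"
      using f N(3) by (auto simp: T_def Q_def)
    then have "card (f ` N) \<le> card (T v \<union> Q v)"
      using P(1) by (intro card_mono) (auto simp: T_def Q_def)
    also have "\<dots> \<le> card (T v) + card (Q v)"
      by (rule card_Un_le)
    finally show ?thesis
      using N(1) by simp
  qed
  \<comment> \<open>The type of a vertex \<open>v\<close> is the pair \<open>(Q v, T v)\<close>.
    There are \<open>4 ^ card P\<close> types, so more than \<open>m\<close> vertices of
    \<open>W\<close> share one.\<close>
  have "card (Pow P \<times> Pow P) = 2 ^ card P * 2 ^ card P"
    using P(1) by (simp add: card_cartesian_product card_Pow)
  also have "\<dots> = (2 * 2) ^ card P"
    by (rule power_mult_distrib[symmetric])
  finally have "card (Pow P \<times> Pow P) = 4 ^ card P"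
    by simp
  then have many: "card (Pow P \<times> Pow P) * m < card W"
    using W(2) by (simp only:)
  have type: "(\<lambda>v. (Q v, T v)) \<in> W \<rightarrow> Pow P \<times> Pow P"
    by (auto simp: Q_def T_def)
  have "finite (Pow P \<times> Pow P)"
    using P(1) by simp
  then obtain b where b: "m < card {v \<in> W. (Q v, T v) = b}"
    by (rule pigeonhole_fibre[OF finW type _ many])
  define Q0 T0 W' where "Q0 = fst b" and "T0 = snd b" and "W' = {v \<in> W. (Q v, T v) = b}"
  have W': "m < card W'" "W' \<subseteq> W" "finite W'" "\<And>v. v \<in> W' \<Longrightarrow> Q v = Q0 \<and> T v = T0"
    using b finW by (auto simp: W'_def Q0_def T0_def)
  then obtain v0 where v0: "v0 \<in> W'"
    by (metis card.empty ex_in_conv not_less0)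
  have T0: "T0 = {p \<in> P. v \<notin> set p \<and> (\<exists>u\<in>set p. adj G v u)}" if "v \<in> W'" for v
    using W'(4)[OF that] by (simp add: T_def)
  have Q0: "Q0 = {p \<in> P. v \<in> set p}" if "v \<in> W'" for v
    using W'(4)[OF that] by (simp add: Q_def)
  have tQT: "t \<le> card T0 + card Q0"
    using QT[of v0] W'(2,4) v0 by auto
  have T0P: "T0 \<subseteq> P"
    using T0[OF v0] by auto
  have inj: "inj_on set P"
    using P(2) disj by (metis inf.idem inj_onI set_empty)
  have rails: "S \<subseteq> verts G \<and> connected_graph (induced G S)" if "S \<in> set ` T0" for S
    using that T0P P(2) connected_path by fastforce
  have rails_disj: "S \<inter> S' = {}" if "S \<in> set ` T0" "S' \<in> set ` T0" "S \<noteq> S'" for S S'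
    using that T0P disj by auto
  have adjT: "v \<notin> S \<and> (\<exists>u\<in>S. adj G v u)" if "v \<in> W'" "S \<in> set ` T0" for v S
    using T0[OF that(1)] that(2) by auto
  have card_set: "card (set ` T0) = card T0"
    using inj T0P by (meson card_image inj_on_subset)
  show ?thesis
  proof (cases "Q0 = {}")
    case True
    then have "t \<le> card (set ` T0)"
      using tQT card_set by simp
    then obtain \<T> where \<T>: "\<T> \<subseteq> set ` T0" "card \<T> = t" "finite \<T>"
      by (rule obtain_subset_with_card_n)
    have "m \<le> card W'"
      using W'(1) by simp
    then obtain W'' where W'': "W'' \<subseteq> W'" "card W'' = m" "finite W''"
      by (rule obtain_subset_with_card_n)
    have "minor (complete_bipartite t m) G"
    proof (rule minor_complete_bipartite[OF \<T>(3,2) _ _ W''(3,2)])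
      show "S \<subseteq> verts G \<and> connected_graph (induced G S)" if "S \<in> \<T>" for S
        using that \<T>(1) by (intro rails) auto
      show "S \<inter> S' = {}" if "S \<in> \<T>" "S' \<in> \<T>" "S \<noteq> S'" for S S'
        using that \<T>(1) by (intro rails_disj) auto
      show "W'' \<subseteq> verts G"
        using W''(1) W'(2) W(1) by blast
      show "v \<notin> S \<and> (\<exists>u\<in>S. adj G v u)" if "v \<in> W''" "S \<in> \<T>" for v S
        using adjT[of v S] that W''(1) \<T>(1) by blast
    qed
    then show ?thesis
      by (simp add: has_obstruction_def)
  next
    case False
    then obtain r where r: "r \<in> Q0"
      by auto
    then have rP: "r \<in> P" "v0 \<in> set r"
      using Q0[OF v0] by auto
    \<comment> \<open>By disjointness only one path passes through a vertex, so at most one of the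
      \<open>t\<close> paths is lost.\<close>
    have "Q0 = {r}"
    proof -
      have "q = r" if "q \<in> Q0" for q
        using disj[of q r] that r Q0[OF v0] by blast
      then show ?thesis
        using r by blast
    qed
    then have "t - 1 \<le> card (set ` T0)"
      using tQT card_set by simp
    then obtain \<T> where \<T>: "\<T> \<subseteq> set ` T0" "card \<T> = t - 1" "finite \<T>"
      by (rule obtain_subset_with_card_n)
    have Wr: "W' \<subseteq> set r"
      using r Q0 by blast
    have "minor (indep_join_path (t - 1) m) G"
    proof (rule minor_indep_join_path[OF \<T>(3,2), where xs = r and W = W'])
      show "S \<subseteq> verts G \<and> connected_graph (induced G S)" if "S \<in> \<T>" for S
        using that \<T>(1) by (intro rails) auto
      show "S \<inter> S' = {}" if "S \<in> \<T>" "S' \<in> \<T>" "S \<noteq> S'" for S S'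
        using that \<T>(1) by (intro rails_disj) auto
      show "successively (adj G) r" "distinct r" "set r \<subseteq> verts G"
        using P(2) rP(1) by auto
      show "m \<le> card (set r \<inter> W')"
        using W'(1) Wr by (simp add: Int_absorb1)
      show "S \<inter> set r = {}" if "S \<in> \<T>" for S
      proof -
        obtain q where q: "q \<in> T0" "S = set q"
          using \<T>(1) \<open>S \<in> \<T>\<close> by auto
        then have "q \<in> P" "q \<noteq> r"
          using T0[OF v0] rP(2) by auto
        then show ?thesis
          using disj[of q r] rP(1) q(2) by auto
      qed
      show "\<exists>u\<in>S. adj G v u" if "v \<in> W'" "S \<in> \<T>" for v S
        using adjT[of v S] that \<T>(1) by blast
    qed (fact \<open>m \<ge> 1\<close>)
    then show ?thesis
      by (simp add: has_obstruction_def)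
  qed
qed

text \<open>The vertices of \<open>X\<close> act as one-vertex paths, on which distinct neighbours
  are automatically on distinct paths.\<close>

lemma obstruction_from_set:
  assumes "simple_graph G" "X \<subseteq> verts G" "W \<subseteq> verts G" "4 ^ card X * m < card W"
    and "\<And>v. v \<in> W \<Longrightarrow> t \<le> card {u \<in> X. adj G v u}" and "m \<ge> 1"
  shows "has_obstruction t m G"
proof -
  let ?P = "(\<lambda>x. [x]) ` X"
  have "finite X"
    using assms(1,2) by (metis finite_subset simple_graph_def)
  have "card ?P = card X"
    by (simp add: card_image inj_on_def)
  show ?thesis
  proof (rule obstruction_from_paths[OF assms(1), of ?P W])
    show "4 ^ card ?P * m < card W"
      using assms(4) \<open>card ?P = card X\<close> by simp
    show "\<exists>N. t \<le> card N \<and> N \<subseteq> (\<Union>p\<in>?P. set p) \<and> (\<forall>u\<in>N. adj G v u) \<and>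
      (\<forall>p\<in>?P. \<forall>u\<in>N \<inter> set p. \<forall>u'\<in>N \<inter> set p. u = u')" if "v \<in> W" for v
      using assms(5)[OF that] by (intro exI[of _ "{u \<in> X. adj G v u}"]) auto
  qed (use assms \<open>finite X\<close> in auto)
qed

lemma strict_mono_on_card:
  fixes V :: "nat \<Rightarrow> 'a set"
  assumes "strict_mono_on {..<n} V" "\<And>i. i < n \<Longrightarrow> finite (V i)" "i + d < n"
  shows "card (V i) + d \<le> card (V (i + d))"
  using assms(3)
proof (induction d)
  case (Suc d)
  have "V (i + d) \<subset> V (i + Suc d)"
    using Suc.prems assms(1) by (simp add: strict_mono_on_def)
  then have "card (V (i + d)) < card (V (i + Suc d))"
    using assms(2)[OF Suc.prems] by (rule psubset_card_mono[rotated])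
  then show ?case
    using Suc by simp
qed simp

text \<open>A separator \<open>Y\<close> contains the boundary of a set between \<open>V0\<close>
  and \<open>V1\<close>, namely \<open>V0\<close> together with all that is reachable from its
  boundary while avoiding \<open>Y\<close>. So \<open>Y\<close> has at least \<open>k\<close>
  elements and Menger's theorem applies.\<close>

lemma Menger_between_nested:
  assumes G: "simple_graph G" and nested: "V0 \<subseteq> V1"
    and min: "\<And>U'. V0 \<subseteq> U' \<Longrightarrow> U' \<subseteq> V1 \<Longrightarrow> k \<le> card (boundary G U')"
  shows "\<exists>P. disjoint_paths {(u, v). adj G u v} (boundary G V0) (boundary G V1) P \<and> card P = k"
proof (rule Menger)
  let ?E = "{(u, v). adj G u v}"
  have "?E \<subseteq> verts G \<times> verts G"
    using simple_graph_adjD[OF G] by blast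
  then show "finite ?E"
    using G by (meson finite_SigmaI finite_subset simple_graph_def)
  show "finite (boundary G V0)"
    by (rule finite_boundary[OF G])
  fix Y assume Y: "finite Y" "separates ?E (boundary G V0) (boundary G V1) Y"
  define U where "U = V0 \<union> {v. \<exists>xs. walk ?E (boundary G V0) {v} xs \<and> set xs \<inter> Y = {}}"
  \<comment> \<open>A walk that avoids \<open>Y\<close> and ends outside \<open>V1\<close> would
    pass the boundary of \<open>V1\<close>, and its initial piece would contradict
    separation.\<close>
  have "U \<subseteq> V1"
  proof (rule ccontr)
    assume "\<not> U \<subseteq> V1"
    then obtain xs where xs: "walk ?E (boundary G V0) UNIV xs" "set xs \<inter> Y = {}" "last xs \<notin> V1"
      using nested by (auto simp: U_def walk_def)
    have "hd xs \<in> V1 \<union> boundary G V1"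
      using xs(1) boundary_of_subset[OF G nested, of "hd xs"] by (auto simp: walk_def)
    then have "\<exists>z\<in>set xs. z \<in> boundary G V1"
      using xs by (intro path_meets_boundary[OF G]) (auto simp: walk_def)
    then obtain z ys zs where z: "z \<in> boundary G V1" "xs = ys @ z # zs"
      by (metis split_list)
    then have "walk ?E (boundary G V0) (boundary G V1) (ys @ [z])"
      using xs(1) by (auto simp: walk_def successively_append_iff hd_append split: if_splits)
    then show False
      using Y(2) xs(2) z(2) unfolding separates_def by fastforce
  qed
  have "boundary G U \<subseteq> Y"
  proof
    fix v assume v: "v \<in> boundary G U"
    then obtain u where u: "u \<in> U" "adj G u v" "v \<notin> U"
      using G by (auto simp: boundary_iff)
    show "v \<in> Y"
    proof (rule ccontr)
      assume "v \<notin> Y"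
      show False
      proof (cases "u \<in> V0")
        case True
        then have "v \<in> boundary G V0"
          using u G by (auto simp: boundary_iff U_def)
        then have "walk ?E (boundary G V0) {v} [v]"
          by (simp add: walk_def)
        then show False
          using u(3) \<open>v \<notin> Y\<close> by (force simp: U_def)
      next
        case False
        then obtain xs where "walk ?E (boundary G V0) {u} xs" "set xs \<inter> Y = {}"
          using u(1) by (auto simp: U_def)
        then have "walk ?E (boundary G V0) {v} (xs @ [v])" "set (xs @ [v]) \<inter> Y = {}"
          using u(2) \<open>v \<notin> Y\<close> by (auto simp: walk_def successively_append_iff)
        then show False
          using u(3) unfolding U_def by blast
      qed
    qed
  qed
  then have "card (boundary G U) \<le> card Y"
    using Y(1) by (rule card_mono[rotated])
  moreover have "k \<le> card (boundary G U)"
    using \<open>U \<subseteq> V1\<close> by (intro min) (auto simp: U_def)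
  ultimately show "k \<le> card Y"
    by simp
qed

text \<open>The cuts \<open>boundary G (V i)\<close> are linked by \<open>k\<close> disjoint paths, each of which meets each cut
  exactly once. A vertex \<open>v\<close> showing that the part strictly between two cuts is not an island has
  all its outside neighbours in one of the two cuts, because the cuts form a sunflower; so these
  neighbours lie on distinct paths.\<close>

lemma obstruction_from_linked_chain:
  fixes V :: "nat \<Rightarrow> 'a set"
  assumes G: "no_small_island t C G"
    and mono: "strict_mono_on {..<n} V"
    and V: "\<And>i. i < n \<Longrightarrow> V i \<subseteq> verts G \<and> card (V i) \<le> C \<and> card (boundary G (V i)) = k"
    and min: "\<And>U'. V 0 \<subseteq> U' \<Longrightarrow> U' \<subseteq> V (n - 1) \<Longrightarrow> k \<le> card (boundary G U')"
    and Z: "\<And>i j. i < n \<Longrightarrow> j < n \<Longrightarrow> i \<noteq> j \<Longrightarrow> boundary G (V i) \<inter> boundary G (V j) = Z"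
    and n: "L * (k + 3) < n" "4 ^ k * m < L" and "m \<ge> 1"
  shows "has_obstruction t m G"
proof -
  have simple: "simple_graph G"
    using G by (simp add: no_small_island_def)
  let ?X = "\<lambda>i. boundary G (V i)"
  let ?E = "{(u, v). adj G u v}"
  \<comment> \<open>Blocks of \<open>k + 3\<close> indices serve two purposes: the sets grow by more
    than \<open>k\<close> vertices, so something remains after removing a cut, and two further
    indices fit strictly between the ends.\<close>
  define q where "q = k + 3"
  have V_mono: "V i \<subseteq> V j" if "i \<le> j" "j < n" for i j
    using mono that by (metis lessThan_iff less_imp_le nle_le order_le_less_trans strict_mono_on_leD subset_eq)
  have fin: "finite (V i)" if "i < n" for i
    using V[OF that] simple by (meson finite_subset simple_graph_def)
  have "n > 0"
    using n(1) by simp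
  have "V 0 \<subseteq> V (n - 1)"
    using \<open>n > 0\<close> by (intro V_mono) auto
  then obtain P where P: "disjoint_paths ?E (?X 0) (?X (n - 1)) P" "card P = k"
    using Menger_between_nested[OF simple _ min] by metis
  have finP: "finite P" and disj: "\<And>p q. p \<in> P \<Longrightarrow> q \<in> P \<Longrightarrow> p \<noteq> q \<Longrightarrow> set p \<inter> set q = {}"
    using P(1) by (simp_all add: disjoint_paths_def)
  have Pp: "p \<noteq> []" "successively (adj G) p" "distinct p" "hd p \<in> ?X 0" "last p \<in> ?X (n - 1)" if "p \<in> P" for p
    using P(1) that by (simp_all add: disjoint_paths_def walk_def)
  have meets: "set p \<inter> ?X i \<noteq> {}" if "p \<in> P" "i < n" for p i
  proof -
    have "hd p \<in> V i \<union> ?X i"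
      using Pp(4)[OF that(1)] boundary_of_subset[OF simple V_mono[of 0 i]] that(2) by blast
    moreover have "last p \<notin> V (n - 1)"
      using Pp(5)[OF that(1)] by (simp add: boundary_def)
    moreover have "V i \<subseteq> V (n - 1)"
      using that(2) by (intro V_mono) linarith+
    ultimately have "hd p \<in> V i \<union> ?X i" "last p \<notin> V i"
      by auto
    then show ?thesis
      using path_meets_boundary[OF simple Pp(2,1)] that(1) by blast
  qed
  \<comment> \<open>Each of the \<open>k\<close> disjoint paths meets the cut, which has only
    \<open>k\<close> vertices.\<close>
  have transversal: "?X i \<subseteq> (\<Union>p\<in>P. set p)"
    "\<And>p u u'. p \<in> P \<Longrightarrow> u \<in> set p \<inter> ?X i \<Longrightarrow> u' \<in> set p \<inter> ?X i \<Longrightarrow> u = u'" if "i < n" for i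
  proof -
    have *: "finite (?X i)" "card (?X i) = card P"
      using V[OF that] P(2) by (simp_all add: finite_boundary[OF simple])
    show "?X i \<subseteq> (\<Union>p\<in>P. set p)"
      using disjoint_transversal(1)[OF finP disj * meets] that by simp
    show "\<And>p u u'. p \<in> P \<Longrightarrow> u \<in> set p \<inter> ?X i \<Longrightarrow> u' \<in> set p \<inter> ?X i \<Longrightarrow> u = u'"
      using disjoint_transversal(2)[OF finP disj * meets] that by simp
  qed
  have "\<exists>v. v \<in> V (s * q + q) \<and> v \<notin> V (s * q) \<and>
      (\<exists>N i. t \<le> card N \<and> i < n \<and> N \<subseteq> ?X i \<and> (\<forall>u\<in>N. adj G v u))" if s: "s < L" for s
  proof -
    define i j l where "i = s * q" and "j = s * q + q" and "l = Suc (s * q)"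
    have "Suc s * q \<le> L * q"
      using s by (intro mult_le_mono1) simp
    then have j: "j < n"
      using n(1) by (simp add: j_def q_def)
    have il: "i < l" "Suc l < j" "i \<le> j" "j = i + q"
      by (auto simp: i_def j_def l_def q_def)
    have sub: "V i \<subseteq> V l" "V l \<subseteq> V (Suc l)" "V (Suc l) \<subseteq> V j"
      using il j V_mono[of i l] V_mono[of l "Suc l"] V_mono[of "Suc l" j] by simp_all
    \<comment> \<open>Removing \<open>?X i\<close> as well ensures that no vertex of
      \<open>S\<close> has a neighbour in \<open>V i\<close>; outside neighbours can only lie in
      \<open>?X i\<close> or \<open>?X j\<close>.\<close>
    define S where "S = V j - (V i \<union> ?X i)"
    have "S \<noteq> {}"
    proof
      assume "S = {}"
      then have "V j \<subseteq> V i \<union> ?X i"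
        by (auto simp: S_def)
      then have "card (V j) \<le> card (V i \<union> ?X i)"
        using fin[of i] il j by (intro card_mono) (auto simp: finite_boundary[OF simple])
      also have "\<dots> \<le> card (V i) + card (?X i)"
        by (rule card_Un_le)
      also have "\<dots> = card (V i) + k"
        using V[of i] il j by simp
      finally show False
        using strict_mono_on_card[OF mono fin, of i q] j il(4) by (simp add: q_def)
    qed
    moreover have "S \<subseteq> verts G" "card S \<le> C"
    proof -
      have "S \<subseteq> V j"
        by (auto simp: S_def)
      then show "S \<subseteq> verts G" "card S \<le> C"
        using V[OF j] card_mono[OF fin[OF j], of S] by auto
    qed
    ultimately obtain v where v: "v \<in> S" "t \<le> card {w \<in> verts G - S. adj G v w}"
      by (rule no_small_islandD[OF G])
    define N where "N = {w \<in> verts G - S. adj G v w}"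
    have vj: "v \<in> V j" "v \<notin> V i" "v \<notin> ?X i"
      using v(1) by (auto simp: S_def)
    have N: "u \<in> ?X i \<or> u \<in> ?X j" if "u \<in> N" for u
    proof -
      have "adj G v u" "adj G u v" "u \<notin> S"
        using that by (auto simp: N_def adj_commute)
      then show ?thesis
        using vj by (auto simp: S_def boundary_iff[OF simple])
    qed
    have crossing: "u \<in> ?X b" if "u \<in> ?X a" "V a \<subseteq> V b" "u \<notin> V b" for a b u
      using boundary_of_subset[OF simple] that by blast
    have XZ: "?X a \<inter> ?X b = Z" if "a \<in> {i, l, Suc l, j}" "b \<in> {i, l, Suc l, j}" "a \<noteq> b" for a b
      using that il j by (intro Z) auto
    \<comment> \<open>If \<open>v\<close> lies inside \<open>V (Suc l)\<close>, its neighbours in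
      \<open>?X j\<close> also lie in \<open>?X (Suc l)\<close>, hence in the kernel
      \<open>Z\<close>, which is part of \<open>?X i\<close>. Otherwise the neighbours in
      \<open>?X i\<close> are pushed into \<open>?X j\<close> through the cut at
      \<open>l\<close>.\<close>
    have "N \<subseteq> ?X i \<or> N \<subseteq> ?X j"
    proof (cases "v \<in> V (Suc l)")
      case True
      have "u \<in> ?X i" if u: "u \<in> N" "u \<in> ?X j" for u
      proof -
        have "u \<notin> V (Suc l)"
          using u(2) sub(3) by (auto simp: boundary_def)
        then have "u \<in> ?X (Suc l)"
          using True u(1) by (auto simp: N_def boundary_iff[OF simple])
        then have "u \<in> Z"
          using XZ[of "Suc l" j] u(2) il by auto
        then show ?thesis
          using XZ[of i j] il by auto
      qed
      then show ?thesis
        using N by blast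
    next
      case False
      then have vl: "v \<notin> V l"
        using sub(2) by auto
      \<comment> \<open>This is why two intermediate cuts are taken: a vertex on the cut at
        \<open>l\<close> but outside \<open>V (Suc l)\<close> would lie on both cuts, hence in
        \<open>Z\<close> and on \<open>?X j\<close>, although it belongs to
        \<open>V j\<close>.\<close>
      have "v \<notin> ?X l"
      proof
        assume *: "v \<in> ?X l"
        then have "v \<in> ?X (Suc l)"
          using crossing[OF _ sub(2) False] by blast
        then have "v \<in> Z"
          using XZ[of l "Suc l"] * by auto
        then have "v \<in> ?X j"
          using XZ[of i j] il by auto
        then show False
          using vj(1) by (simp add: boundary_def)
      qed
      have "u \<in> ?X j" if u: "u \<in> N" "u \<in> ?X i" for u
      proof -
        have "u \<notin> V l"
          using \<open>v \<notin> ?X l\<close> vl u(1) by (auto simp: N_def boundary_iff[OF simple] adj_commute)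
        then have "u \<in> ?X l"
          using crossing[OF u(2) sub(1)] by blast
        then have "u \<in> Z"
          using XZ[of i l] u(2) il by auto
        then show ?thesis
          using XZ[of i j] il by auto
      qed
      then show ?thesis
        using N by blast
    qed
    then have "\<exists>a<n. N \<subseteq> ?X a"
      using il j by (meson order_le_less_trans)
    then show ?thesis
      using vj(1,2) v(2) unfolding N_def i_def j_def by blast
  qed
  then have "\<forall>s\<in>{..<L}. \<exists>v. v \<in> V (s * q + q) \<and> v \<notin> V (s * q) \<and>
      (\<exists>N i. t \<le> card N \<and> i < n \<and> N \<subseteq> ?X i \<and> (\<forall>u\<in>N. adj G v u))"
    by simp
  then obtain w where w: "\<forall>s\<in>{..<L}. w s \<in> V (s * q + q) \<and> w s \<notin> V (s * q) \<and>
      (\<exists>N i. t \<le> card N \<and> i < n \<and> N \<subseteq> ?X i \<and> (\<forall>u\<in>N. adj G (w s) u))"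
    by (rule bchoice[THEN exE])
  have bound: "s * q + q < n" if "s < L" for s
  proof -
    have "Suc s * q \<le> L * q"
      using that by (intro mult_le_mono1) simp
    then show ?thesis
      using n(1) by (simp add: q_def)
  qed
  have w_neq: "w s \<noteq> w s'" if "s < s'" "s' < L" for s s'
  proof -
    have "Suc s * q \<le> s' * q"
      using that by (intro mult_le_mono1) simp
    then have "V (s * q + q) \<subseteq> V (s' * q)"
      using bound[OF that(2)] by (intro V_mono) auto
    then show ?thesis
      using w that by (metis lessThan_iff less_trans subsetD)
  qed
  have "inj_on w {..<L}"
    using w_neq by (metis inj_onI lessThan_iff linorder_neqE_nat)
  then have card: "card (w ` {..<L}) = L"
    by (simp add: card_image)
  show ?thesis
  proof (rule obstruction_from_paths[OF simple finP, of "w ` {..<L}"])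
    show "p \<noteq> [] \<and> successively (adj G) p \<and> distinct p \<and> set p \<subseteq> verts G" if "p \<in> P" for p
    proof -
      have "hd p \<in> verts G"
        using Pp(4)[OF that] by (simp add: boundary_def)
      moreover have "set p \<subseteq> verts G" if "p \<noteq> []" "successively (adj G) p" "hd p \<in> verts G" for p
        using that
      proof (induction p)
        case (Cons x xs)
        then show ?case
          using simple_graph_adjD(3)[OF simple] by (cases "xs = []") (auto simp: successively_Cons)
      qed simp
      ultimately show ?thesis
        using Pp(1-3)[OF that] by blast
    qed
    show "w ` {..<L} \<subseteq> verts G"
      using w V bound by (auto dest!: bspec)
    show "4 ^ card P * m < card (w ` {..<L})"
      using card P(2) n(2) by simp
    show "\<exists>N. t \<le> card N \<and> N \<subseteq> (\<Union>p\<in>P. set p) \<and> (\<forall>u\<in>N. adj G v u) \<and>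
      (\<forall>p\<in>P. \<forall>u\<in>N \<inter> set p. \<forall>u'\<in>N \<inter> set p. u = u')" if v: "v \<in> w ` {..<L}" for v
    proof -
      obtain s where "s \<in> {..<L}" "v = w s"
        using v by (rule imageE)
      then obtain N i where N: "t \<le> card N" "i < n" "N \<subseteq> ?X i" "\<forall>u\<in>N. adj G v u"
        using w by (metis (no_types, lifting))
      moreover have "u = u'" if "p \<in> P" "u \<in> N \<inter> set p" "u' \<in> N \<inter> set p" for p u u'
        using transversal(2)[OF N(2) that(1), of u u'] that(2,3) N(3) by auto
      moreover have "N \<subseteq> (\<Union>p\<in>P. set p)"
        using N(3) transversal(1)[OF N(2)] by (rule subset_trans)
      ultimately show ?thesis
        by (intro exI[of _ N] conjI ballI) auto
    qed
  qed (use disj \<open>m \<ge> 1\<close> in auto)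
qed

lemma obstruction_from_window:
  assumes "m \<ge> 1"
  shows "\<exists>n. \<forall>(G :: 'a graph) C (U :: nat \<Rightarrow> 'a set). no_small_island t C G \<longrightarrow> strict_mono_on {..<n} U \<longrightarrow>
     (\<forall>i<n. U i \<subseteq> verts G \<and> card (U i) \<le> C \<and> card (boundary G (U i)) = k) \<longrightarrow>
     (\<forall>i<n. \<forall>j<n. \<forall>U'. U i \<subseteq> U' \<and> U' \<subseteq> U j \<longrightarrow> k \<le> card (boundary G U')) \<longrightarrow>
     has_obstruction t m G"
proof -
  \<comment> \<open>\<open>L\<close> blocks yield \<open>L\<close> distinct vertices, one more than
    \<open>4 ^ k * m\<close>; \<open>n0\<close> is the number of cuts needed for so many blocks, and
    \<open>n\<close> makes the sunflower lemma provide \<open>n0\<close> cuts.\<close>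
  define L where "L = Suc (4 ^ k * m)"
  define n0 where "n0 = Suc (L * (k + 3))"
  obtain n where n: "\<And>(I :: nat set) (X :: nat \<Rightarrow> 'a set).
     finite I \<Longrightarrow> n \<le> card I \<Longrightarrow> (\<forall>i\<in>I. finite (X i) \<and> card (X i) \<le> k) \<Longrightarrow>
     (\<exists>J\<subseteq>I. card J = n0 \<and> (\<exists>Z. \<forall>i\<in>J. \<forall>j\<in>J. i \<noteq> j \<longrightarrow> X i \<inter> X j = Z))"
    using sunflower[where 'i = nat and 'a = 'a] by metis
  have obstruction: "has_obstruction t m G"
    if G: "no_small_island t C G" and mono: "strict_mono_on {..<n} U"
      and U: "\<forall>i<n. U i \<subseteq> verts G \<and> card (U i) \<le> C \<and> card (boundary G (U i)) = k"
      and min: "\<forall>i<n. \<forall>j<n. \<forall>U'. U i \<subseteq> U' \<and> U' \<subseteq> U j \<longrightarrow> k \<le> card (boundary G U')"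
    for G :: "'a graph" and C and U :: "nat \<Rightarrow> 'a set"
  proof -
    have simple: "simple_graph G"
      using G by (simp add: no_small_island_def)
    have "\<exists>J\<subseteq>{..<n}. card J = n0 \<and>
        (\<exists>Z. \<forall>i\<in>J. \<forall>j\<in>J. i \<noteq> j \<longrightarrow> boundary G (U i) \<inter> boundary G (U j) = Z)"
      by (rule n) (use U in \<open>auto simp: finite_boundary[OF simple]\<close>)
    then obtain J Z where J: "J \<subseteq> {..<n}" "card J = n0"
      and Z: "\<forall>i\<in>J. \<forall>j\<in>J. i \<noteq> j \<longrightarrow> boundary G (U i) \<inter> boundary G (U j) = Z"
      by (elim exE conjE)
    have "finite J"
      using J(1) finite_subset by blast
    then obtain r where r: "strict_mono_on {..<n0} r" "\<forall>i<n0. r i \<in> J"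
      using finite_enumerate[of J] J(2) by auto
    have rn: "r i < n" if "i < n0" for i
      using r(2) J(1) that by auto
    show ?thesis
    proof (rule obstruction_from_linked_chain[OF G, where V = "\<lambda>i. U (r i)" and n = n0 and k = k and L = L and Z = Z])
      show "strict_mono_on {..<n0} (\<lambda>i. U (r i))"
        using mono r(1) rn by (simp add: strict_mono_on_def)
      show "U (r i) \<subseteq> verts G \<and> card (U (r i)) \<le> C \<and> card (boundary G (U (r i))) = k" if "i < n0" for i
        using U rn[OF that] by simp
      show "k \<le> card (boundary G U')" if "U (r 0) \<subseteq> U'" "U' \<subseteq> U (r (n0 - 1))" for U'
        using min rn[of 0] rn[of "n0 - 1"] that by (simp add: n0_def)
      show "boundary G (U (r i)) \<inter> boundary G (U (r j)) = Z" if "i < n0" "j < n0" "i \<noteq> j" for i j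
      proof -
        have "r i \<noteq> r j"
          using r(1) that by (auto simp: strict_mono_on_def) (metis less_irrefl linorder_neqE_nat)
        then show ?thesis
          using Z r(2) that by simp
      qed
      show "L * (k + 3) < n0" "4 ^ k * m < L"
        by (simp_all add: n0_def L_def)
    qed (fact assms)
  qed
  show ?thesis
    by (intro exI[of _ n] allI impI) (rule obstruction)
qed

text \<open>Cut the chain into windows. If every window contains, between two of its sets, a set with
  smaller boundary, then these sets form a long chain for the next smaller boundary size.\<close>

lemma obstruction_from_chain:
  assumes "m \<ge> 1"
  shows "\<exists>n. \<forall>(G :: 'a graph) C (U :: nat \<Rightarrow> 'a set). no_small_island t C G \<longrightarrow> strict_mono_on {..<n} U \<longrightarrow>
     (\<forall>i<n. U i \<subseteq> verts G \<and> card (U i) \<le> C \<and> card (boundary G (U i)) < k) \<longrightarrow>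
     has_obstruction t m G"
proof (induction k)
  case 0
  \<comment> \<open>A single set already contradicts the hypothesis, as no boundary has fewer than 0
    vertices.\<close>
  show ?case
    by (intro exI[of _ 1] allI impI) auto
next
  case (Suc k)
  then obtain n0 where n0: "\<And>(G :: 'a graph) C (U :: nat \<Rightarrow> 'a set). no_small_island t C G \<Longrightarrow> strict_mono_on {..<n0} U \<Longrightarrow>
     (\<forall>i<n0. U i \<subseteq> verts G \<and> card (U i) \<le> C \<and> card (boundary G (U i)) < k) \<Longrightarrow>
     has_obstruction t m G"
    by metis
  obtain n1 where n1: "\<And>(G :: 'a graph) C (U :: nat \<Rightarrow> 'a set). no_small_island t C G \<Longrightarrow> strict_mono_on {..<n1} U \<Longrightarrow>
     (\<forall>i<n1. U i \<subseteq> verts G \<and> card (U i) \<le> C \<and> card (boundary G (U i)) = k) \<Longrightarrow>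
     (\<forall>i<n1. \<forall>j<n1. \<forall>U'. U i \<subseteq> U' \<and> U' \<subseteq> U j \<longrightarrow> k \<le> card (boundary G U')) \<Longrightarrow>
     has_obstruction t m G"
    using obstruction_from_window[OF assms, where 'a = 'a] by metis
  \<comment> \<open>There are \<open>n0\<close> windows of \<open>n1\<close> consecutive sets. Sets
    sandwiched within successive windows inherit strict inclusion; in a window without a smaller
    cut, all boundaries have size exactly \<open>k\<close>.\<close>
  have obstruction: "has_obstruction t m G"
    if G: "no_small_island t C G" and mono: "strict_mono_on {..<n0 * n1} U"
      and U: "\<forall>i<n0 * n1. U i \<subseteq> verts G \<and> card (U i) \<le> C \<and> card (boundary G (U i)) < Suc k"
    for G :: "'a graph" and C and U :: "nat \<Rightarrow> 'a set"
  proof (cases "\<forall>a\<in>{..<n0}. \<exists>U'. card (boundary G U') < k \<and>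
      (\<exists>i<n1. \<exists>j<n1. U (a * n1 + i) \<subseteq> U' \<and> U' \<subseteq> U (a * n1 + j))")
    case True
    then obtain U' where U': "\<forall>a\<in>{..<n0}. card (boundary G (U' a)) < k \<and>
      (\<exists>i<n1. \<exists>j<n1. U (a * n1 + i) \<subseteq> U' a \<and> U' a \<subseteq> U (a * n1 + j))"
      by (rule bchoice[THEN exE])
    have index: "a * n1 + i < b * n1" if "i < n1" "a < b" for a b i
    proof -
      have "Suc a * n1 \<le> b * n1"
        using that(2) by (intro mult_le_mono1) simp
      then show ?thesis
        using that(1) by simp
    qed
    show ?thesis
    proof (rule n0[OF G, of U'])
      show "strict_mono_on {..<n0} U'"
      proof (rule strict_mono_onI)
        fix a b assume ab: "a \<in> {..<n0}" "b \<in> {..<n0}" "a < b"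
        obtain j where j: "j < n1" "U' a \<subseteq> U (a * n1 + j)"
          using U' ab(1) by blast
        obtain i where i: "i < n1" "U (b * n1 + i) \<subseteq> U' b"
          using U' ab(2) by blast
        have "a * n1 + j < b * n1 + i" "b * n1 + i < n0 * n1"
          using index[OF j(1) ab(3)] index[OF i(1), of b n0] ab(2) by auto
        then have "U (a * n1 + j) \<subset> U (b * n1 + i)"
          using mono by (simp add: strict_mono_on_def)
        then show "U' a \<subset> U' b"
          using i(2) j(2) by blast
      qed
      show "\<forall>a<n0. U' a \<subseteq> verts G \<and> card (U' a) \<le> C \<and> card (boundary G (U' a)) < k"
      proof (intro allI impI)
        fix a assume a: "a < n0"
        then obtain j where j: "j < n1" "U' a \<subseteq> U (a * n1 + j)"
          using U' by blast
        have "a * n1 + j < n0 * n1"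
          using index[OF j(1) a] .
        then have *: "U (a * n1 + j) \<subseteq> verts G" "card (U (a * n1 + j)) \<le> C"
          using U by auto
        have "finite (U (a * n1 + j))"
          using *(1) G by (metis finite_subset no_small_island_def simple_graph_def)
        then have "card (U' a) \<le> C"
          using card_mono[OF _ j(2)] *(2) by simp
        then show "U' a \<subseteq> verts G \<and> card (U' a) \<le> C \<and> card (boundary G (U' a)) < k"
          using U' a *(1) j(2) by auto
      qed
    qed
  next
    case False
    then obtain a where a: "a < n0" and
      min: "\<And>U' i j. i < n1 \<Longrightarrow> j < n1 \<Longrightarrow> U (a * n1 + i) \<subseteq> U' \<Longrightarrow> U' \<subseteq> U (a * n1 + j) \<Longrightarrow>
        k \<le> card (boundary G U')"
      by (metis lessThan_iff not_le)
    have index: "a * n1 + i < n0 * n1" if "i < n1" for i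
    proof -
      have "Suc a * n1 \<le> n0 * n1"
        using a by (intro mult_le_mono1) simp
      then show ?thesis
        using that by simp
    qed
    show ?thesis
    proof (rule n1[OF G, of "\<lambda>i. U (a * n1 + i)"])
      show "strict_mono_on {..<n1} (\<lambda>i. U (a * n1 + i))"
        using mono index by (simp add: strict_mono_on_def)
      show "\<forall>i<n1. U (a * n1 + i) \<subseteq> verts G \<and> card (U (a * n1 + i)) \<le> C \<and>
          card (boundary G (U (a * n1 + i))) = k"
      proof (intro allI impI)
        fix i assume i: "i < n1"
        then show "U (a * n1 + i) \<subseteq> verts G \<and> card (U (a * n1 + i)) \<le> C \<and>
            card (boundary G (U (a * n1 + i))) = k"
          using U index[OF i] min[OF i i subset_refl subset_refl] by (simp add: less_Suc_eq_le le_antisym)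
      qed
      show "\<forall>i<n1. \<forall>j<n1. \<forall>U'. U (a * n1 + i) \<subseteq> U' \<and> U' \<subseteq> U (a * n1 + j) \<longrightarrow>
          k \<le> card (boundary G U')"
        using min by simp
    qed
  qed
  show ?case
    by (intro exI[of _ "n0 * n1"] allI impI) (rule obstruction)
qed

section \<open>Tree decompositions\<close>

lemma successively_imp_rtranclp:
  assumes "successively R xs" "xs \<noteq> []"
  shows "R\<^sup>*\<^sup>* (hd xs) (last xs)"
  using assms
  by (induction xs) (auto simp: successively_Cons intro: converse_rtranclp_into_rtranclp)

text \<open>A detour made into a path has an inner vertex, since it avoids the edge itself; together
  with the edge it closes to a cycle.\<close>

lemma tree_edge_is_bridge:
  assumes "tree T" "adj T a b"
  shows "\<not> (\<lambda>u v. adj T u v \<and> {u, v} \<noteq> {a, b})\<^sup>*\<^sup>* a b"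
proof
  let ?R = "\<lambda>u v. adj T u v \<and> {u, v} \<noteq> {a, b}"
  assume "?R\<^sup>*\<^sup>* a b"
  then obtain xs where xs: "xs \<noteq> []" "hd xs = a" "last xs = b" "successively ?R xs" "distinct xs"
    using rtranclp_distinct_path[of ?R a b] by blast
  have "a \<noteq> b"
    using assms simple_graph_adjD(1) by (metis tree_def)
  then obtain c ys where ys: "xs = a # c # ys"
    using xs(1-3) by (metis last.simps list.collapse list.exhaust)
  have "ys \<noteq> []"
    using xs(3,4) ys by auto
  then have "length xs \<ge> 3"
    using ys by (cases ys) auto
  moreover have "successively (adj T) xs"
    by (rule successively_mono[OF xs(4)]) simp
  ultimately have "cycle T xs"
    using xs assms(2) by (simp add: cycle_def adj_commute)
  then show False
    using assms(1) by (simp add: tree_def)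
qed

lemma bags_of_vertex_connected:
  assumes "tree_decomposition G T B" "v \<in> verts G"
    and "z \<in> verts T" "z' \<in> verts T" "v \<in> B z" "v \<in> B z'"
  shows "(adj (induced T {x. v \<in> B x}))\<^sup>*\<^sup>* z z'"
  using assms unfolding tree_decomposition_def connected_graph_def by (simp add: verts_induced)

lemma bag_of_edge:
  assumes "tree_decomposition G T B" "adj G u v"
  obtains z where "z \<in> verts T" "u \<in> B z" "v \<in> B z"
proof -
  have "\<exists>x\<in>verts T. {u, v} \<subseteq> B x"
    using assms unfolding tree_decomposition_def adj_def by (elim conjE) (erule bspec)
  then show thesis
    using that by auto
qed

lemma bag_of_vertex:
  assumes "tree_decomposition G T B" "v \<in> verts G"
  obtains z where "z \<in> verts T" "v \<in> B z"
proof -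
  have "v \<in> (\<Union>x\<in>verts T. B x)"
    using assms by (simp add: tree_decomposition_def)
  then show thesis
    using that by auto
qed

text \<open>Follow a walk inside \<open>D\<close>: the bags of each vertex are connected in the
  tree, and the bags of consecutive vertices share a node, because some bag contains the
  edge.\<close>

lemma bags_of_connected_set:
  assumes "tree_decomposition G T B"
    and "D \<subseteq> verts G" "(adj (induced G D))\<^sup>*\<^sup>* d d'" "d \<in> D"
    and "z \<in> verts T" "z' \<in> verts T" "d \<in> B z" "d' \<in> B z'"
  shows "(adj (induced T {x. B x \<inter> D \<noteq> {}}))\<^sup>*\<^sup>* z z'"
  using assms(3,6,8)
proof (induction arbitrary: z' rule: rtranclp_induct)
  case base
  have "(adj (induced T {x. d \<in> B x}))\<^sup>*\<^sup>* z z'"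
    using assms base by (intro bags_of_vertex_connected) auto
  then show ?case
    using \<open>d \<in> D\<close> by (auto elim!: rtranclp_adj_induced_mono)
next
  case (step c c')
  then have c: "adj G c c'" "c \<in> D" "c' \<in> D"
    by (simp_all add: adj_induced)
  obtain y where y: "y \<in> verts T" "c \<in> B y" "c' \<in> B y"
    using bag_of_edge[OF assms(1) c(1)] .
  have "(adj (induced T {x. c' \<in> B x}))\<^sup>*\<^sup>* y z'"
    using assms(1,2) c(3) y step.prems by (intro bags_of_vertex_connected) auto
  then have "(adj (induced T {x. B x \<inter> D \<noteq> {}}))\<^sup>*\<^sup>* y z'"
    by (rule rtranclp_adj_induced_mono) (use c(3) in auto)
  with step.IH[OF y(1,2)] show ?case
    by (rule rtranclp_trans)
qed

text \<open>Walk in the tree from \<open>x\<close> to the first bag meeting \<open>D\<close>. A boundary vertex missing from that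
  bag would give a second connection across the last edge of the walk.\<close>

lemma bag_meeting_connected_set:
  assumes td: "tree_decomposition G T B" and simple: "simple_graph G"
    and D: "D \<subseteq> verts G" "connected_graph (induced G D)"
    and x: "x \<in> verts T" "boundary G D \<subseteq> B x"
  obtains y where "y \<in> verts T" "boundary G D \<subseteq> B y" "B y \<inter> D \<noteq> {}"
proof (cases "B x \<inter> D = {}")
  case False
  then show ?thesis
    using x that by blast
next
  case True
  have T: "tree T" "simple_graph T" "connected_graph T"
    using td by (auto simp: tree_decomposition_def tree_def)
  have connD: "(adj (induced G D))\<^sup>*\<^sup>* d d'" if "d \<in> D" "d' \<in> D" for d d'
    using D that by (simp add: connected_induced_iff)
  obtain d0 where d0: "d0 \<in> D"
    using D by (auto simp: connected_induced_iff)
  then obtain z0 where z0: "z0 \<in> verts T" "d0 \<in> B z0"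
    using bag_of_vertex[OF td, of d0] D(1) by blast
  have "(adj T)\<^sup>*\<^sup>* x z0"
    using T(3) x(1) z0(1) by (simp add: connected_graph_def)
  then obtain xs where xs: "xs \<noteq> []" "hd xs = x" "last xs = z0" "successively (adj T) xs"
    using rtranclp_distinct_path[of "adj T" x z0] by blast
  have "z0 \<in> set xs" "B z0 \<inter> D \<noteq> {}"
    using xs(1,3) d0 z0(2) by auto
  then have "\<exists>z\<in>set xs. B z \<inter> D \<noteq> {}"
    by blast
  then obtain ys y zs where split: "xs = ys @ y # zs" "B y \<inter> D \<noteq> {}" "\<forall>z\<in>set ys. \<not> B z \<inter> D \<noteq> {}"
    using split_list_first_prop[of xs "\<lambda>z. B z \<inter> D \<noteq> {}"] by blast
  have ys: "ys \<noteq> []" "hd ys = x"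
    using xs(2) split True by (auto simp: hd_append split: if_splits)
  define a where "a = last ys"
  have ay: "adj T a y" and succ: "successively (adj T) ys"
    using xs(4) ys(1) by (simp_all add: split(1) a_def successively_append_iff)
  have a: "B a \<inter> D = {}"
    using split(3) ys(1) by (simp add: a_def)
  have y: "y \<in> verts T"
    using simple_graph_adjD(3)[OF T(2) ay] .
  let ?R = "\<lambda>u v. adj T u v \<and> {u, v} \<noteq> {a, y}"
  have avoid: "?R\<^sup>*\<^sup>* u v" if "(adj (induced T S))\<^sup>*\<^sup>* u v" "a \<notin> S \<or> y \<notin> S" for S u v
    by (rule rtranclp_mono[THEN predicate2D, OF _ that(1)])
      (use that(2) in \<open>auto simp: adj_induced doubleton_eq_iff\<close>)
  have sym: "?R\<^sup>*\<^sup>* v u" if "?R\<^sup>*\<^sup>* u v" for u v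
  proof -
    have "symp ?R"
      by (auto intro!: sympI simp: adj_commute insert_commute)
    from sympD[OF symp_rtranclp[OF this] that] show ?thesis .
  qed
  have "boundary G D \<subseteq> B y"
  proof
    fix u assume u: "u \<in> boundary G D"
    show "u \<in> B y"
    proof (rule ccontr)
      assume "u \<notin> B y"
      obtain d where d: "d \<in> D" "adj G d u"
        using u by (auto simp: boundary_def)
      obtain z where z: "z \<in> verts T" "d \<in> B z" "u \<in> B z"
        using bag_of_edge[OF td d(2)] .
      \<comment> \<open>The bypass of the bridge goes from \<open>a\<close> back to
        \<open>x\<close>, then to \<open>z\<close> through bags containing \<open>u\<close>, none of
        which is at \<open>y\<close>, and finally to \<open>y\<close> through bags meeting
        \<open>D\<close>, none of which is at \<open>a\<close>.\<close>
      have "(adj (induced T {x. u \<in> B x}))\<^sup>*\<^sup>* x z"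
        using u x z by (intro bags_of_vertex_connected[OF td]) (auto simp: boundary_def)
      then have xz: "?R\<^sup>*\<^sup>* x z"
        by (rule avoid) (use \<open>u \<notin> B y\<close> in simp)
      obtain d' where d': "d' \<in> B y" "d' \<in> D"
        using split(2) by blast
      have "(adj (induced T {x. B x \<inter> D \<noteq> {}}))\<^sup>*\<^sup>* z y"
        using bags_of_connected_set[OF td D(1) connD[OF d(1) d'(2)] d(1) z(1) y z(2) d'(1)] .
      then have zy: "?R\<^sup>*\<^sup>* z y"
        by (rule avoid) (use a in simp)
      have "successively ?R ys"
      proof (rule successively_mono[OF succ])
        fix u v assume uv: "u \<in> set ys" "v \<in> set ys" "adj T u v"
        then have "u \<noteq> y" "v \<noteq> y"
          using split(2,3) by auto
        then show "?R u v"
          using uv(3) by (auto simp: doubleton_eq_iff)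
      qed
      then have "?R\<^sup>*\<^sup>* x a"
        using successively_imp_rtranclp[of ?R ys] ys by (simp add: a_def)
      then have "?R\<^sup>*\<^sup>* a x"
        by (rule sym)
      then have "?R\<^sup>*\<^sup>* a z"
        using xz by (rule rtranclp_trans)
      then have "?R\<^sup>*\<^sup>* a y"
        using zy by (rule rtranclp_trans)
      then show False
        using tree_edge_is_bridge[OF T(1) ay] by blast
    qed
  qed
  then show ?thesis
    using y split(2) that by blast
qed

lemma treewidth_bags:
  assumes "simple_graph G" "treewidth G \<le> w"
  obtains T B where "tree_decomposition G T B" "\<And>x. x \<in> verts T \<Longrightarrow> card (B x) \<le> Suc w"
proof -
  \<comment> \<open>The decomposition with one bag shows that some width exists, so the
    \<open>LEAST\<close> in \<open>treewidth\<close> is attained.\<close>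
  let ?T = "Graph {0::nat} {}"
  have "tree ?T"
  proof -
    have "\<not> cycle ?T xs" for xs
      by (auto simp: cycle_def adj_def)
    then show ?thesis
      by (auto simp: tree_def simple_graph_def connected_graph_def)
  qed
  moreover have "connected_graph (induced ?T {x::nat. v \<in> verts G})" if "v \<in> verts G" for v
    using that by (auto simp: connected_graph_def induced_def)
  ultimately have "tree_decomposition G ?T (\<lambda>_. verts G)"
    using assms(1) by (auto simp: tree_decomposition_def simple_graph_def)
  then have "\<exists>w T B. tree_decomposition G T B \<and> width T B = w"
    by blast
  then have "\<exists>T B. tree_decomposition G T B \<and> width T B = treewidth G"
    unfolding treewidth_def by (rule LeastI_ex)
  then obtain T B where TB: "tree_decomposition G T B" "width T B = treewidth G"
    by blast
  have "card (B x) \<le> Suc w" if "x \<in> verts T" for x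
  proof -
    have "finite (verts T)"
      using TB(1) by (simp add: tree_decomposition_def tree_def simple_graph_def)
    then have "card (B x) \<le> Max ((\<lambda>x. card (B x)) ` verts T)"
      using that by (intro Max_ge) auto
    then show ?thesis
      using TB(2) assms(2) by (simp add: width_def)
  qed
  then show ?thesis
    using TB(1) that by blast
qed

section \<open>Finding a small island\<close>

definition components_in :: "'a graph \<Rightarrow> 'a set \<Rightarrow> 'a set set" where
  "components_in G S = (\<lambda>v. {u. (adj (induced G S))\<^sup>*\<^sup>* v u}) ` S"

lemma components_in:
  assumes simple: "simple_graph G" and S: "S \<subseteq> verts G"
  shows "\<Union>(components_in G S) = S"
    and "\<And>K. K \<in> components_in G S \<Longrightarrow> K \<noteq> {} \<and> K \<subseteq> S"
    and "\<And>K. K \<in> components_in G S \<Longrightarrow> connected_graph (induced G K)"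
    and "\<And>K K'. K \<in> components_in G S \<Longrightarrow> K' \<in> components_in G S \<Longrightarrow> K \<noteq> K' \<Longrightarrow> K \<inter> K' = {}"
    and "\<And>K. K \<in> components_in G S \<Longrightarrow> boundary G K \<inter> S = {}"
proof -
  let ?R = "adj (induced G S)"
  have reach: "u \<in> S" if "?R\<^sup>*\<^sup>* v u" "v \<in> S" for u v
    using that by (induction rule: rtranclp_induct) (auto simp: adj_induced)
  show KS: "K \<noteq> {} \<and> K \<subseteq> S" if "K \<in> components_in G S" for K
    using that reach by (auto simp: components_in_def)
  have "S \<subseteq> \<Union>(components_in G S)"
    by (auto simp: components_in_def)
  then show "\<Union>(components_in G S) = S"
    using KS by blast
  show "connected_graph (induced G K)" if K: "K \<in> components_in G S" for K
  proof -
    obtain v where v: "v \<in> S" "K = {u. ?R\<^sup>*\<^sup>* v u}"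
      using K by (auto simp: components_in_def)
    have vK: "(adj (induced G K))\<^sup>*\<^sup>* v u" if "?R\<^sup>*\<^sup>* v u" for u
      using that
    proof (induction rule: rtranclp_induct)
      case (step c c')
      then have "c \<in> K" "c' \<in> K"
        by (auto simp: v(2))
      then have "adj (induced G K) c c'"
        using step.hyps(2) by (simp add: adj_induced)
      with step.IH show ?case ..
    qed simp
    have "(adj (induced G K))\<^sup>*\<^sup>* u u'" if "u \<in> K" "u' \<in> K" for u u'
      using vK that rtranclp_adj_commute rtranclp_trans unfolding v(2) mem_Collect_eq by metis
    then show ?thesis
      using KS[OF K] S by (subst connected_induced_iff) auto
  qed
  show "K \<inter> K' = {}" if "K \<in> components_in G S" "K' \<in> components_in G S" "K \<noteq> K'" for K K'
  proof (rule ccontr)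
    assume "K \<inter> K' \<noteq> {}"
    then obtain u where u: "u \<in> K" "u \<in> K'"
      by blast
    obtain v v' where v: "K = {u. ?R\<^sup>*\<^sup>* v u}" "K' = {u. ?R\<^sup>*\<^sup>* v' u}"
      using \<open>K \<in> components_in G S\<close> \<open>K' \<in> components_in G S\<close> by (auto simp: components_in_def)
    have "?R\<^sup>*\<^sup>* v u" "?R\<^sup>*\<^sup>* v' u"
      using u v by auto
    then have "?R\<^sup>*\<^sup>* v v'" "?R\<^sup>*\<^sup>* v' v"
      using rtranclp_adj_commute rtranclp_trans by metis+
    then have "K = K'"
      unfolding v using rtranclp_trans[of ?R] by blast
    then show False
      using \<open>K \<noteq> K'\<close> by blast
  qed
  show "boundary G K \<inter> S = {}" if K: "K \<in> components_in G S" for K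
  proof (rule ccontr)
    assume "boundary G K \<inter> S \<noteq> {}"
    then obtain u c where u: "u \<in> S" "u \<notin> K" "c \<in> K" "adj G c u"
      by (auto simp: boundary_def)
    obtain v where v: "K = {u. ?R\<^sup>*\<^sup>* v u}"
      using K by (auto simp: components_in_def)
    have "?R c u"
      using u KS[OF K] by (auto simp: adj_induced)
    then have "u \<in> K"
      using u(3) unfolding v by (auto intro: rtranclp.rtrancl_into_rtrancl)
    then show False
      using u(2) by blast
  qed
qed

text \<open>The invariant of the descent: the bag bounds the size of the boundary, and connectedness
  allows it to be exchanged for a bag that meets \<open>D\<close>.\<close>

definition bag_bounded :: "'a graph \<Rightarrow> nat graph \<Rightarrow> (nat \<Rightarrow> 'a set) \<Rightarrow> 'a set \<Rightarrow> bool" where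
  "bag_bounded G T B D \<longleftrightarrow>
     D \<subseteq> verts G \<and> connected_graph (induced G D) \<and> (\<exists>x\<in>verts T. boundary G D \<subseteq> B x)"

text \<open>If the components of \<open>D\<close> minus a bag are small, none of them is an island; so each has a vertex
  with \<open>t\<close> neighbours in the bag, and boundedly many components produce an obstruction.\<close>

lemma large_component:
  assumes td: "tree_decomposition G T B" "\<forall>x\<in>verts T. card (B x) \<le> b"
    and G: "no_small_island t C G" "\<not> has_obstruction t m G" "m \<ge> 1"
    and D: "bag_bounded G T B D" "b + 4 ^ b * m * s < card D"
    and small: "\<And>K. bag_bounded G T B K \<Longrightarrow> K \<subset> D \<Longrightarrow> card K \<le> C"
  obtains K where "bag_bounded G T B K" "K \<subset> D" "s < card K"
proof -
  have simple: "simple_graph G"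
    using G(1) by (simp add: no_small_island_def)
  then have finG: "finite (verts G)"
    by (simp add: simple_graph_def)
  have DG: "D \<subseteq> verts G" and "connected_graph (induced G D)"
    using D(1) by (simp_all add: bag_bounded_def)
  \<comment> \<open>The bag must meet \<open>D\<close> so that the components of the rest are proper
    subsets and the descent makes progress.\<close>
  then obtain y where y: "y \<in> verts T" "boundary G D \<subseteq> B y" "B y \<inter> D \<noteq> {}"
    using bag_meeting_connected_set[OF td(1) simple] D(1) unfolding bag_bounded_def by metis
  have ByG: "B y \<subseteq> verts G"
    using td(1) y(1) by (auto simp: tree_decomposition_def)
  define \<K> where "\<K> = components_in G (D - B y)"
  have "D - B y \<subseteq> verts G"
    using DG by auto
  note comp = components_in[OF simple this, folded \<K>_def]
  have finD: "finite D"
    using finite_subset[OF DG finG] .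
  have fin\<K>: "finite \<K>"
    using finD by (simp add: \<K>_def components_in_def)
  \<comment> \<open>A neighbour of \<open>K\<close> inside \<open>D\<close> lies in the bag because
    \<open>K\<close> is a whole component; one outside \<open>D\<close> belongs to the boundary of
    \<open>D\<close>.\<close>
  have boundary_K: "boundary G K \<subseteq> B y" if "K \<in> \<K>" for K
  proof
    fix v assume v: "v \<in> boundary G K"
    have "v \<in> D \<or> v \<in> boundary G D"
      using v comp(2)[OF that] by (auto simp: boundary_def)
    then show "v \<in> B y"
      using comp(5)[OF that] v y(2) by blast
  qed
  have K: "bag_bounded G T B K" "K \<subset> D" if "K \<in> \<K>" for K
  proof -
    show "K \<subset> D"
      using comp(2)[OF that] y(3) by blast
    then show "bag_bounded G T B K"
      using DG comp(3)[OF that] boundary_K[OF that] y(1) unfolding bag_bounded_def by blast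
  qed
  have "\<forall>K\<in>\<K>. \<exists>v. v \<in> K \<and> t \<le> card {u \<in> B y. adj G v u}"
  proof
    fix K assume "K \<in> \<K>"
    have "K \<noteq> {}" "K \<subseteq> verts G" "card K \<le> C"
      using comp(2)[OF \<open>K \<in> \<K>\<close>] K[OF \<open>K \<in> \<K>\<close>] DG small by auto
    then obtain v where v: "v \<in> K" "t \<le> card {w \<in> verts G - K. adj G v w}"
      by (rule no_small_islandD[OF G(1)])
    have "{w \<in> verts G - K. adj G v w} \<subseteq> {u \<in> B y. adj G v u}"
      using boundary_K[OF \<open>K \<in> \<K>\<close>] v(1) by (auto simp: boundary_def)
    then have "card {w \<in> verts G - K. adj G v w} \<le> card {u \<in> B y. adj G v u}"
      using finite_subset[OF ByG finG] by (intro card_mono) auto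
    then show "\<exists>v. v \<in> K \<and> t \<le> card {u \<in> B y. adj G v u}"
      using v by (intro exI[of _ v]) simp
  qed
  then obtain f where f: "\<forall>K\<in>\<K>. f K \<in> K \<and> t \<le> card {u \<in> B y. adj G (f K) u}"
    by (rule bchoice[THEN exE])
  have "inj_on f \<K>"
  proof (rule inj_onI, rule ccontr)
    fix K K' assume KK': "K \<in> \<K>" "K' \<in> \<K>" "f K = f K'" "K \<noteq> K'"
    then have "f K \<in> K \<inter> K'"
      using f by fastforce
    then show False
      using comp(4)[OF KK'(1,2,4)] by simp
  qed
  then have "card (f ` \<K>) = card \<K>"
    by (rule card_image)
  have "card \<K> \<le> 4 ^ b * m"
  proof (rule ccontr)
    assume "\<not> ?thesis"
    moreover have "4 ^ card (B y) * m \<le> 4 ^ b * m"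
      using bspec[OF td(2) y(1)] by (intro mult_le_mono1 power_increasing) auto
    ultimately have "4 ^ card (B y) * m < card (f ` \<K>)"
      unfolding \<open>card (f ` \<K>) = card \<K>\<close> by linarith
    moreover have "f ` \<K> \<subseteq> verts G"
      using f K(2) DG by blast
    moreover have "t \<le> card {u \<in> B y. adj G v u}" if "v \<in> f ` \<K>" for v
      using f that by auto
    ultimately have "has_obstruction t m G"
      using obstruction_from_set[OF simple ByG] G(3) by blast
    then show False
      using G(2) by blast
  qed
  have "\<exists>K\<in>\<K>. s < card K"
  proof (rule ccontr)
    assume "\<not> ?thesis"
    then have le: "\<And>K. K \<in> \<K> \<Longrightarrow> card K \<le> s"
      by (simp add: not_less)
    have "D \<subseteq> B y \<union> \<Union>\<K>"
      using comp(1) by blast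
    then have "card D \<le> card (B y \<union> \<Union>\<K>)"
      using finite_subset[OF ByG finG] comp(1) finD by (intro card_mono) auto
    also have "\<dots> \<le> card (B y) + card (\<Union>\<K>)"
      by (rule card_Un_le)
    also have "card (\<Union>\<K>) \<le> (\<Sum>K\<in>\<K>. card K)"
      by (rule card_Union_le_sum_card)
    also have "(\<Sum>K\<in>\<K>. card K) \<le> card \<K> * s"
      using sum_bounded_above[of \<K> card s] le by simp
    also have "card \<K> * s \<le> 4 ^ b * m * s"
      using \<open>card \<K> \<le> 4 ^ b * m\<close> by (rule mult_le_mono1)
    finally show False
      using D(2) bspec[OF td(2) y(1)] by simp
  qed
  then show ?thesis
    using K that by blast
qed

text \<open>Inverts the loss in \<open>large_component\<close>: for \<open>M = 4 ^ b * m\<close>, a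
  set above the bound for \<open>Suc n\<close> loses at most \<open>b\<close> vertices to the bag
  and splits into at most \<open>M\<close> components, one of which exceeds the bound for
  \<open>n\<close>.\<close>

fun chain_bound :: "nat \<Rightarrow> nat \<Rightarrow> nat \<Rightarrow> nat" where
  "chain_bound b M 0 = 0"
| "chain_bound b M (Suc n) = b + M * chain_bound b M n"

text \<open>Repeated passage to a large component, listed from the smallest set up to
  \<open>D\<close>; \<open>card D \<le> C\<close> makes every component met on the way small, as
  \<open>large_component\<close> requires.\<close>

lemma long_chain:
  assumes td: "tree_decomposition G T B" "\<forall>x\<in>verts T. card (B x) \<le> b"
    and G: "no_small_island t C G" "\<not> has_obstruction t m G" "m \<ge> 1"
    and D: "bag_bounded G T B D" "card D \<le> C" "chain_bound b (4 ^ b * m) n < card D"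
  shows "\<exists>U :: nat \<Rightarrow> 'a set. strict_mono_on {..n} U \<and> U n = D \<and>
    (\<forall>i\<le>n. bag_bounded G T B (U i) \<and> card (U i) \<le> C)"
  using D
proof (induction n arbitrary: D)
  case 0
  then show ?case
    by (intro exI[of _ "\<lambda>_. D"]) (auto simp: strict_mono_on_def)
next
  case (Suc n)
  have "finite D"
    using Suc.prems(3) by (metis card.infinite not_less0)
  then have small: "card K \<le> C" if "K \<subset> D" for K
    using card_mono[of D K] that Suc.prems(2) by auto
  obtain K where K: "bag_bounded G T B K" "K \<subset> D" "chain_bound b (4 ^ b * m) n < card K"
    using large_component[OF td G Suc.prems(1) _ small] Suc.prems(3)
    by (metis chain_bound.simps(2))
  from Suc.IH[OF K(1) small[OF K(2)] K(3)] obtain U :: "nat \<Rightarrow> 'a set" where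
    U: "strict_mono_on {..n} U" "U n = K" "\<forall>i\<le>n. bag_bounded G T B (U i) \<and> card (U i) \<le> C"
    by (elim exE conjE)
  define V where "V = U(Suc n := D)"
  have sub: "U i \<subseteq> K" if "i \<le> n" for i
  proof (cases "i = n")
    case False
    then have "U i \<subset> U n"
      using U(1) that by (simp add: strict_mono_on_def)
    then show ?thesis
      using U(2) by blast
  qed (use U(2) in simp)
  have "strict_mono_on {..Suc n} V"
  proof (rule strict_mono_onI)
    fix i j assume ij: "i \<in> {..Suc n}" "j \<in> {..Suc n}" "i < j"
    show "V i < V j"
    proof (cases "j = Suc n")
      case True
      then show ?thesis
        using ij sub[of i] K(2) by (auto simp: V_def)
    next
      case False
      then show ?thesis
        using ij U(1) by (auto simp: V_def strict_mono_on_def)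
    qed
  qed
  moreover have "\<forall>i\<le>Suc n. bag_bounded G T B (V i) \<and> card (V i) \<le> C"
    using U(3) Suc.prems(1,2) by (auto simp: V_def le_Suc_eq)
  moreover have "V (Suc n) = D"
    by (simp add: V_def)
  ultimately show ?case
    by (intro exI[of _ V] conjI)
qed

theorem bounded_treewidth_small_island:
  assumes "t \<ge> 1" "m \<ge> 1"
  shows "\<exists>C\<ge>1. \<forall>G :: 'a graph. simple_graph G \<longrightarrow> verts G \<noteq> {} \<longrightarrow> treewidth G \<le> w \<longrightarrow>
    \<not> has_obstruction t m G \<longrightarrow> (\<exists>S. island t G S \<and> card S \<le> C)"
proof -
  define b where "b = Suc w"
  obtain n where n: "\<And>(G :: 'a graph) C (U :: nat \<Rightarrow> 'a set). no_small_island t C G \<Longrightarrow>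
     strict_mono_on {..<n} U \<Longrightarrow>
     (\<forall>i<n. U i \<subseteq> verts G \<and> card (U i) \<le> C \<and> card (boundary G (U i)) < Suc b) \<Longrightarrow>
     has_obstruction t m G"
    using obstruction_from_chain[OF assms(2), where 'a = 'a] by metis
  \<comment> \<open>One descent more than \<open>n\<close> is provided for: the first leads from a
    set above \<open>C\<close> to one of size at most \<open>C\<close>, and only from there on is
    the chain recorded.\<close>
  define C where "C = Suc (chain_bound b (4 ^ b * m) (Suc n))"
  have "\<exists>S. island t G S \<and> card S \<le> C"
    if simple: "simple_graph G" and ne: "verts G \<noteq> {}" and tw: "treewidth G \<le> w"
      and no: "\<not> has_obstruction t m G" for G :: "'a graph"
  proof (rule ccontr)
    assume "\<not> ?thesis"
    then have G: "no_small_island t C G"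
      using simple by (auto simp: no_small_island_def not_le)
    obtain T B where td: "tree_decomposition G T B" "\<forall>x\<in>verts T. card (B x) \<le> b"
      using treewidth_bags[OF simple tw] unfolding b_def by metis
    have T: "verts T \<noteq> {}"
      using td(1) by (simp add: tree_decomposition_def tree_def connected_graph_def)
    have finG: "finite (verts G)"
      using simple by (simp add: simple_graph_def)
    obtain K where K: "K \<in> components_in G (verts G)"
      using ne by (auto simp: components_in_def)
    note comp = components_in[OF simple subset_refl]
    have "boundary G K = {}"
      using comp(5)[OF K] by (auto simp: boundary_def)
    then have "bag_bounded G T B K"
      using comp(2,3)[OF K] T by (auto simp: bag_bounded_def)
    \<comment> \<open>A whole component has no outside neighbours, so it is an island because
      \<open>t\<close> is positive, and therefore exceeds \<open>C\<close>. It starts the search for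
      a smallest set of this kind.\<close>
    moreover have "island t G K"
    proof -
      have "{w \<in> verts G - K. adj G v w} = {}" if "v \<in> K" for v
        using \<open>boundary G K = {}\<close> that by (auto simp: boundary_def)
      then have "card {w \<in> verts G - K. adj G v w} < t" if "v \<in> K" for v
        using assms(1) that by (simp only: card.empty)
      then show ?thesis
        using comp(2)[OF K] by (simp add: island_def)
    qed
    then have "C < card K"
      using G by (simp add: no_small_island_def)
    ultimately have "\<exists>D. bag_bounded G T B D \<and> C < card D"
      by blast
    then obtain D where D: "bag_bounded G T B D" "C < card D"
      and least: "\<And>K. bag_bounded G T B K \<Longrightarrow> C < card K \<Longrightarrow> card D \<le> card K"
      using ex_has_least_nat[of "\<lambda>D. bag_bounded G T B D \<and> C < card D" _ card] by blast
    have "finite D"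
      using D(2) by (metis card.infinite not_less0)
    have small: "card K \<le> C" if "bag_bounded G T B K" "K \<subset> D" for K
      using least[OF that(1)] psubset_card_mono[OF \<open>finite D\<close> that(2)] by (meson not_le)
    have big: "b + 4 ^ b * m * chain_bound b (4 ^ b * m) n < card D"
      using D(2) by (simp add: C_def)
    obtain K where K: "bag_bounded G T B K" "K \<subset> D" "chain_bound b (4 ^ b * m) n < card K"
      by (rule large_component[OF td G no assms(2) D(1) big small])
    from long_chain[OF td G no assms(2) K(1) small[OF K(1,2)] K(3)] obtain U :: "nat \<Rightarrow> 'a set" where
      U: "strict_mono_on {..n} U" "\<forall>i\<le>n. bag_bounded G T B (U i) \<and> card (U i) \<le> C"
      by (elim exE conjE)
    have "has_obstruction t m G"
    proof (rule n[OF G])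
      show "strict_mono_on {..<n} U"
        using U(1) by (simp add: strict_mono_on_def)
      show "\<forall>i<n. U i \<subseteq> verts G \<and> card (U i) \<le> C \<and> card (boundary G (U i)) < Suc b"
      proof (intro allI impI)
        fix i assume "i < n"
        then have "bag_bounded G T B (U i)" "card (U i) \<le> C"
          using U(2) by auto
        moreover from this obtain x where x: "x \<in> verts T" "boundary G (U i) \<subseteq> B x"
          by (auto simp: bag_bounded_def)
        have "B x \<subseteq> verts G"
          using td(1) x(1) by (auto simp: tree_decomposition_def)
        then have "card (boundary G (U i)) \<le> card (B x)"
          using x(2) finG by (intro card_mono) (auto intro: finite_subset)
        then have "card (boundary G (U i)) < Suc b"
          using bspec[OF td(2) x(1)] by simp
        ultimately show "U i \<subseteq> verts G \<and> card (U i) \<le> C \<and> card (boundary G (U i)) < Suc b"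
          by (simp add: bag_bounded_def)
      qed
    qed
    then show False
      using no by blast
  qed
  moreover have "C \<ge> 1"
    by (simp add: C_def)
  ultimately show ?thesis
    by (intro exI[of _ C]) simp
qed

section \<open>The characterization\<close>

lemma island_mono: "island s G S \<Longrightarrow> s \<le> t \<Longrightarrow> island t G S"
  by (auto simp: island_def)

lemma subgraph_imp_minor:
  assumes "subgraph H G"
  shows "minor H G"
proof -
  have sub: "simple_graph H" "verts H \<subseteq> verts G" "edges H \<subseteq> edges G"
    using assms by (auto simp: subgraph_def)
  have "connected_graph (induced G {x})" if "x \<in> verts H" for x
    using that sub(2) by (intro connected_singleton) auto
  moreover have "adj G x y" if "adj H x y" for x y
    using that sub(3) by (auto simp: adj_def)
  ultimately show ?thesis
    using sub(2) unfolding minor_def by (intro exI[of _ "\<lambda>x. {x}"]) auto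
qed

section \<open>The least values in \<open>col\<close> and \<open>col_star\<close>\<close>

lemma col_le:
  assumes "\<And>H. subgraph H G \<Longrightarrow> verts H \<noteq> {} \<Longrightarrow> \<exists>S. island t H S \<and> card S \<le> C"
  shows "col C G \<le> t"
  unfolding col_def using assms by (intro Least_le) blast

text \<open>The \<open>LEAST\<close> in \<open>col\<close> is attained, since single vertices are
  islands for a threshold above the number of vertices; this is where \<open>C \<ge> 1\<close>
  enters.\<close>

lemma col_le_imp_island:
  assumes "simple_graph G" "verts G \<noteq> {}" "col C G \<le> t" "C \<ge> 1"
  shows "\<exists>S. island t G S \<and> card S \<le> C"
proof -
  let ?P = "\<lambda>t. \<forall>H. subgraph H G \<and> verts H \<noteq> {} \<longrightarrow> (\<exists>S. island t H S \<and> card S \<le> C)"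
  have "?P (Suc (card (verts G)))"
  proof (intro allI impI)
    fix H assume H: "subgraph H G \<and> verts H \<noteq> {}"
    then obtain v where v: "v \<in> verts H"
      by blast
    have "card {w \<in> verts H - {v}. adj H v w} \<le> card (verts G)"
      using H assms(1) by (intro card_mono) (auto simp: subgraph_def simple_graph_def)
    then have "island (Suc (card (verts G))) H {v}"
      using v by (simp add: island_def)
    then show "\<exists>S. island (Suc (card (verts G))) H S \<and> card S \<le> C"
      using assms(4) by (intro exI[of _ "{v}"]) simp
  qed
  then have "?P (col C G)"
    unfolding col_def by (rule LeastI)
  moreover have "subgraph G G"
    using assms(1) by (simp add: subgraph_def)
  ultimately show ?thesis
    using assms(2,3) island_mono by blast
qed

lemma col_star_le_iff:
  "col_star \<G> \<le> enat t \<longleftrightarrow> (\<exists>C\<ge>1. \<forall>G\<in>\<G>. col C G \<le> t)"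
proof
  let ?A = "{enat t | t. \<exists>C\<ge>1. \<forall>G\<in>\<G>. col C G \<le> t}"
  assume le: "col_star \<G> \<le> enat t"
  have "?A \<noteq> {}"
  proof
    assume empty: "?A = {}"
    have "col_star \<G> = \<infinity>"
      unfolding col_star_def empty Inf_enat_def by simp
    then show False
      using le by simp
  qed
  \<comment> \<open>On \<open>enat\<close>, the infimum of a non-empty set is its least element, so
    one constant \<open>C\<close> realises it.\<close>
  then have "col_star \<G> \<in> ?A"
    unfolding col_star_def Inf_enat_def by (simp only: if_False) (meson LeastI_ex ex_in_conv)
  then obtain s C where "col_star \<G> = enat s" "C \<ge> 1" "\<forall>G\<in>\<G>. col C G \<le> s"
    by blast
  then show "\<exists>C\<ge>1. \<forall>G\<in>\<G>. col C G \<le> t"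
    using le by (metis enat_ord_simps(1) order_trans)
next
  assume "\<exists>C\<ge>1. \<forall>G\<in>\<G>. col C G \<le> t"
  then show "col_star \<G> \<le> enat t"
    unfolding col_star_def by (intro Inf_lower) blast
qed

text \<open>If \<open>S\<close> has at most \<open>C\<close> vertices, each vertex on the side of
  size \<open>t\<close> has at least \<open>m - C\<close> neighbours outside \<open>S\<close>, so
  \<open>S\<close> avoids this side. But then every vertex of \<open>S\<close> has all
  \<open>t\<close> vertices of that side as outside neighbours.\<close>

lemma complete_bipartite_islands_large:
  assumes "t + C \<le> m" "island t (complete_bipartite t m) S"
  shows "C < card S"
proof (rule ccontr)
  assume "\<not> ?thesis"
  let ?G = "complete_bipartite t m"
  have verts: "verts ?G = {..<t + m}"
    by (simp add: complete_bipartite_def)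
  have S: "S \<noteq> {}" "S \<subseteq> {..<t + m}" "\<And>v. v \<in> S \<Longrightarrow> card {w \<in> {..<t + m} - S. adj ?G v w} < t"
    using assms(2) by (simp_all add: island_def verts)
  have finS: "finite S"
    using S(2) finite_subset by blast
  have small: "v \<notin> S" if "v < t" for v
  proof
    assume v: "v \<in> S"
    have "m - C \<le> card ({t..<t + m} - S)"
      using diff_card_le_card_Diff[OF finS, of "{t..<t + m}"] \<open>\<not> C < card S\<close> by simp
    also have "\<dots> \<le> card {w \<in> {..<t + m} - S. adj ?G v w}"
      using that by (intro card_mono) (auto simp: adj_complete_bipartite)
    finally show False
      using S(3)[OF v] assms(1) by linarith
  qed
  obtain v where v: "v \<in> S"
    using S(1) by blast
  have "card {..<t} \<le> card {w \<in> {..<t + m} - S. adj ?G v w}"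
    using small v S(2) by (intro card_mono) (auto simp: adj_complete_bipartite not_less)
  then show False
    using S(3)[OF v] by simp
qed

text \<open>A small island contains none of the \<open>n\<close> vertices joined to the path, for
  they have too many neighbours outside. Hence it lies on the path without exhausting it, and a
  vertex next to a gap has \<open>n + 1\<close> outside neighbours.\<close>

lemma indep_join_path_islands_large:
  assumes "n + C < m" "island (Suc n) (indep_join_path n m) S"
  shows "C < card S"
proof (rule ccontr)
  assume "\<not> ?thesis"
  let ?G = "indep_join_path n m"
  have verts: "verts ?G = {..<n + m}"
    by (simp add: indep_join_path_def)
  have S: "S \<noteq> {}" "S \<subseteq> {..<n + m}" "\<And>v. v \<in> S \<Longrightarrow> card {w \<in> {..<n + m} - S. adj ?G v w} < Suc n"
    using assms(2) by (simp_all add: island_def verts)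
  have finS: "finite S"
    using S(2) finite_subset by blast
  have large: "m - C \<le> card ({n..<n + m} - S)"
    using diff_card_le_card_Diff[OF finS, of "{n..<n + m}"] \<open>\<not> C < card S\<close> by simp
  have small: "v \<notin> S" if "v < n" for v
  proof
    assume v: "v \<in> S"
    have "card ({n..<n + m} - S) \<le> card {w \<in> {..<n + m} - S. adj ?G v w}"
      using that by (intro card_mono) (auto simp: adj_indep_join_path)
    then show False
      using large S(3)[OF v] assms(1) by linarith
  qed
  \<comment> \<open>Otherwise \<open>S\<close> is closed under moving along the path in both
    directions and contains all of it, against the size bound.\<close>
  have "\<exists>v\<in>S. \<exists>w\<in>{n..<n + m} - S. adj ?G v w"
  proof (rule ccontr)
    assume no: "\<not> ?thesis"
    have up: "Suc v \<in> S" if "v \<in> S" "Suc v < n + m" for v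
      using no that small[of v] by (force simp: adj_indep_join_path not_less)
    have down: "v \<in> S" if "Suc v \<in> S" "n \<le> v" for v
      using no that S(2) by (force simp: adj_indep_join_path)
    obtain v0 where v0: "v0 \<in> S"
      using S(1) by blast
    have "v \<in> S" if "v0 \<le> v" "v < n + m" for v
      using that by (induction v rule: dec_induct) (auto simp: v0 intro: up)
    moreover have "v \<in> S" if "n \<le> v" "v \<le> v0" for v
      using that(2,1) by (induction v rule: inc_induct) (auto simp: v0 intro: down)
    ultimately have "{n..<n + m} - S = {}"
      by (auto simp: not_le) (meson linear)
    then have "card ({n..<n + m} - S) = 0"
      by (simp only: card.empty)
    then show False
      using large assms(1) by linarith
  qed
  then obtain v w where vw: "v \<in> S" "w \<in> {n..<n + m}" "w \<notin> S" "adj ?G v w"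
    by blast
  have "insert w {..<n} \<subseteq> {w \<in> {..<n + m} - S. adj ?G v w}"
    using vw small S(2) by (auto simp: adj_indep_join_path not_less)
  then have "card (insert w {..<n}) \<le> card {w \<in> {..<n + m} - S. adj ?G v w}"
    by (intro card_mono) auto
  moreover have "card (insert w {..<n}) = Suc n"
    using vw(2) by simp
  ultimately show False
    using S(3)[OF vw(1)] by simp
qed

theorem theorem7:
  fixes \<G> :: "nat graph set" and t :: nat
  assumes "minor_closed_class \<G>"
    and "bounded_treewidth \<G>"
    and "t \<ge> 1"
  shows "col_star \<G> \<le> enat t \<longleftrightarrow>
    (\<exists>m\<ge>1. complete_bipartite t m \<notin> \<G> \<and> indep_join_path (t - 1) m \<notin> \<G>)"
proof
  assume "col_star \<G> \<le> enat t"
  then obtain C where C: "C \<ge> 1" "\<forall>G\<in>\<G>. col C G \<le> t"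
    by (auto simp: col_star_le_iff)
  \<comment> \<open>The value \<open>m = t + C\<close> meets both size conditions,
    \<open>t + C \<le> m\<close> and \<open>(t - 1) + C < m\<close>.\<close>
  have "complete_bipartite t (t + C) \<notin> \<G>"
  proof
    assume "complete_bipartite t (t + C) \<in> \<G>"
    then have "\<exists>S. island t (complete_bipartite t (t + C)) S \<and> card S \<le> C"
      using C assms(3) by (intro col_le_imp_island simple_complete_bipartite)
        (auto simp: complete_bipartite_def)
    then show False
      using complete_bipartite_islands_large[OF order_refl] by (auto simp: not_less[symmetric])
  qed
  moreover have "indep_join_path (t - 1) (t + C) \<notin> \<G>"
  proof
    assume "indep_join_path (t - 1) (t + C) \<in> \<G>"
    moreover have "0 \<in> verts (indep_join_path (t - 1) (t + C))"
      using assms(3) by (simp add: indep_join_path_def)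
    ultimately have "\<exists>S. island t (indep_join_path (t - 1) (t + C)) S \<and> card S \<le> C"
      using C by (intro col_le_imp_island simple_indep_join_path) auto
    then show False
      using indep_join_path_islands_large[of "t - 1" C "t + C"] assms(3) by (auto simp: not_less[symmetric])
  qed
  ultimately show "\<exists>m\<ge>1. complete_bipartite t m \<notin> \<G> \<and> indep_join_path (t - 1) m \<notin> \<G>"
    using assms(3) by (intro exI[of _ "t + C"]) simp
next
  assume "\<exists>m\<ge>1. complete_bipartite t m \<notin> \<G> \<and> indep_join_path (t - 1) m \<notin> \<G>"
  then obtain m where m: "m \<ge> 1" "complete_bipartite t m \<notin> \<G>" "indep_join_path (t - 1) m \<notin> \<G>"
    by blast
  have closed: "H \<in> \<G>" if "G \<in> \<G>" "simple_graph H" "minor H G" for G H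
    using assms(1) that unfolding minor_closed_class_def by blast
  obtain w where w: "\<forall>G\<in>\<G>. treewidth G \<le> w"
    using assms(2) by (auto simp: bounded_treewidth_def)
  obtain C where C: "C \<ge> 1" and island: "\<And>G :: nat graph. simple_graph G \<Longrightarrow> verts G \<noteq> {} \<Longrightarrow>
      treewidth G \<le> w \<Longrightarrow> \<not> has_obstruction t m G \<Longrightarrow> \<exists>S. island t G S \<and> card S \<le> C"
    using bounded_treewidth_small_island[OF assms(3) m(1), where 'a = nat] by metis
  have "col C G \<le> t" if "G \<in> \<G>" for G
  proof (rule col_le)
    \<comment> \<open>Subgraphs are minors, so \<open>H\<close> stays in the class and inherits both
      the treewidth bound and the absence of obstructions.\<close>
    fix H assume H: "subgraph H G" "verts H \<noteq> {}"
    then have simple: "simple_graph H"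
      by (simp add: subgraph_def)
    then have "H \<in> \<G>"
      using closed[OF \<open>G \<in> \<G>\<close> _ subgraph_imp_minor[OF H(1)]] by blast
    moreover have "\<not> has_obstruction t m H"
      using closed[OF \<open>H \<in> \<G>\<close>] m(2,3) simple_complete_bipartite simple_indep_join_path
      unfolding has_obstruction_def by blast
    ultimately show "\<exists>S. island t H S \<and> card S \<le> C"
      using island[OF simple H(2)] w by blast
  qed
  then show "col_star \<G> \<le> enat t"
    using C by (auto simp: col_star_le_iff)
qed

end
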